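(* The $n+1$ images, under the circular shift group $C_{n+1}$, of the collection of the $n$ hyper-rhombic cells $\xi_i+\Diamond_{i,n+1}$ ($1\le i\le n$) of $V(\mathbf 0)$ sharing the vertex $-\xi_{n+1}$ form the boundary of $V(\mathbf 0)$. Overall, the boundary of $V(\mathbf 0)$ is composed of the $n(n+1)$ congruent hyper-rhombic faces $$\{\xi_i+\Diamond_{ij}:1\le i\ne j\le n+1\}.$$ Moreover, the face $\xi_i+\Diamond_{ij}$ ($1\le i\ne j\le n+1$) has the following properties. (1) It is obtained by transforming $\xi_1+\Diamond_{1,n+1}$ with the matrix $$\Gamma_{n+1,\;j\bmod (n+1)}\begin{bmatrix}\Gamma_{n,\;(i-j-1)\bmod n}&0\\0&1\end{bmatrix}.$$ (2) It is embedded in the bisecting hyperplane of the nearest neighbor point $e_i-e_j\in A_n$, i.e. the hyperplane bisecting the segment between $\mathbf 0$ and $e_i-e_j$. (3) It is composed of the images, under $S_{n+1}$, of the roof of $\sigma_0$ that share the edge connecting $\xi_i$ and $-\xi_j$.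
   Context: Let $n$ be the dimension of the lattice, $\mathbf 1=(1,\dots,1)^T\in\mathbb R^{n+1}$, $H=\{x\in\mathbb R^{n+1}:x\cdot\mathbf 1=0\}$, and let $e_i$ be the standard unit vectors. The lattice $A_n$ is $\mathbb Z^{n+1}\cap H$. Its Voronoi cell at the origin, taken inside $H$, is $V(\mathbf 0)=\{x\in H:\|x\|\le\|x-q\|\text{ for all }q\in A_n\}$, and its boundary is taken relative to $H$. A cell of $V(\mathbf 0)$ is an $(n-1)$-dimensional face of it. Let $\xi_i=e_i-\frac1{n+1}\mathbf 1$ for $1\le i\le n+1$. For $i\ne j$ put $\Diamond_{ij}=\Diamond_{i,j}=\{\sum_{k\ne i,j}t_k\xi_k:0\le t_k\le1\}$, the $(n-1)$-dimensional parallelepiped spanned by all $\xi_k$ with $k\in\{1,\dots,n+1\}\setminus\{i,j\}$. Let $v_j=\sum_{i=1}^j\xi_i$ for $0\le j\le n$, let $\sigma_0$ be the convex hull of $\{v_0,\dots,v_n\}$, and let the roof of $\sigma_0$ be its face equal to the convex hull of $\{v_1,\dots,v_n\}$. $S_m$ denotes the group of $m\times m$ permutation matrices. For $0\le j\le m-1$, $\Gamma_{m,j}$ is the $m\times m$ circular shift matrix obtained by circularly shifting the rows of the identity matrix downward by $j$, i.e. $\Gamma_{m,j}e_i=e_{i+j}$ with indices taken modulo $m$ in $\{1,\dots,m\}$; $C_m=\{\Gamma_{m,j}:0\le j\le m-1\}$. Here $a\bmod m$ denotes the residue of $a$ in $\{0,\dots,m-1\}$. An $m$-dimensional hyper-rhombus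 is a parallelepiped all of whose faces are congruent $(m-1)$-dimensional hyper-rhombi; this definition is recursive, with 2-dimensional rhombi as its base case. Congruent means related by an isometry. "Composed of" means being the union of the listed pieces, which do not overlap (they may meet along their boundaries).
   Formalization: In (1) the exponent (i-j-1) mod n is replaced by (((i-j) mod (n+1))-1) mod n; the two agree for j<i, but the printed one is false for all i<j when n≥2 (e.g. n=2, i=1, j=3 gives the swap of coordinates 1 and 2, where the identity is needed). *)

theory Defs
  imports "HOL-Analysis.Analysis"
begin

text \<open>
  The space \<open>R^(n+1)\<close> is \<^typ>\<open>real ^ 'm\<close> with \<open>CARD('m) = n + 1\<close>. The index type carries no
  canonical numbering, so the notions that refer to the positions \<open>1, \<dots>, n + 1\<close> take a labelling
  \<open>c :: nat \<Rightarrow> 'm\<close>, which is meant to be a bijection from \<open>{1..n+1}\<close> onto \<open>UNIV\<close>.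
\<close>

definition all_ones :: "real ^ 'm::finite" where
  "all_ones = (\<chi> k. 1)"

definition H_space :: "(real ^ 'm::finite) set" where
  "H_space = {x. x \<bullet> all_ones = 0}"

definition A_lattice :: "(real ^ 'm::finite) set" where
  "A_lattice = {x \<in> H_space. \<forall>k. x $ k \<in> \<int>}"

definition voronoi0 :: "(real ^ 'm::finite) set" where
  "voronoi0 = {x \<in> H_space. \<forall>q \<in> A_lattice. norm x \<le> norm (x - q)}"

definition boundary0 :: "(real ^ 'm::finite) set" where
  "boundary0 = top_of_set H_space frontier_of voronoi0"

definition is_cell :: "nat \<Rightarrow> (real ^ 'm::finite) set \<Rightarrow> bool" where
  "is_cell n F \<longleftrightarrow> F face_of voronoi0 \<and> aff_dim F = int n - 1"

definition unit_vec :: "(nat \<Rightarrow> 'm) \<Rightarrow> nat \<Rightarrow> real ^ 'm::finite" where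
  "unit_vec c i = axis (c i) 1"

definition xi :: "nat \<Rightarrow> (nat \<Rightarrow> 'm) \<Rightarrow> nat \<Rightarrow> real ^ 'm::finite" where
  "xi n c i = unit_vec c i - (1 / real (n + 1)) *\<^sub>R all_ones"

definition diamond :: "nat \<Rightarrow> (nat \<Rightarrow> 'm) \<Rightarrow> nat \<Rightarrow> nat \<Rightarrow> (real ^ 'm::finite) set" where
  "diamond n c i j =
     {(\<Sum>k \<in> {1..n+1} - {i, j}. t k *\<^sub>R xi n c k) | t.
        \<forall>k \<in> {1..n+1} - {i, j}. 0 \<le> t k \<and> t k \<le> 1}"

definition rhombic_face :: "nat \<Rightarrow> (nat \<Rightarrow> 'm) \<Rightarrow> nat \<Rightarrow> nat \<Rightarrow> (real ^ 'm::finite) set" where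
  "rhombic_face n c i j = (+) (xi n c i) ` diamond n c i j"

definition corner_cells :: "nat \<Rightarrow> (nat \<Rightarrow> 'm) \<Rightarrow> (real ^ 'm::finite) set set" where
  "corner_cells n c = {rhombic_face n c i (n+1) | i. i \<in> {1..n}}"

definition rhombic_faces :: "nat \<Rightarrow> (nat \<Rightarrow> 'm) \<Rightarrow> (real ^ 'm::finite) set set" where
  "rhombic_faces n c =
     {rhombic_face n c i j | i j. i \<in> {1..n+1} \<and> j \<in> {1..n+1} \<and> i \<noteq> j}"

definition sigma_vertex :: "nat \<Rightarrow> (nat \<Rightarrow> 'm) \<Rightarrow> nat \<Rightarrow> real ^ 'm::finite" where
  "sigma_vertex n c j = (\<Sum>i = 1..j. xi n c i)"

definition sigma0 :: "nat \<Rightarrow> (nat \<Rightarrow> 'm) \<Rightarrow> (real ^ 'm::finite) set" where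
  "sigma0 n c = convex hull (sigma_vertex n c ` {0..n})"

text \<open>The face of \<^const>\<open>sigma0\<close> opposite to the vertex \<open>v_0 = 0\<close>.\<close>

definition roof :: "nat \<Rightarrow> (nat \<Rightarrow> 'm) \<Rightarrow> (real ^ 'm::finite) set" where
  "roof n c = convex hull (sigma_vertex n c ` {1..n})"

definition permutation_matrices :: "(real ^ 'm ^ 'm::finite) set" where
  "permutation_matrices = {(\<chi> r s. if r = p s then 1 else 0) | p. p permutes UNIV}"

text \<open>
  Matrices whose size depends on \<open>n\<close> are given by their entries at natural row and column numbers,
  counted from 1; \<open>labelled_matrix\<close> turns an \<open>(n+1) \<times> (n+1)\<close> table into a matrix. In column \<open>s\<close> of
  \<open>shift_entries m j\<close> the entry 1 is in row \<open>s + j\<close>, taken modulo \<open>m\<close> in \<open>{1..m}\<close>.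
\<close>

definition shift_entries :: "nat \<Rightarrow> nat \<Rightarrow> nat \<Rightarrow> nat \<Rightarrow> real" where
  "shift_entries m j r s = (if r = (s + j - 1) mod m + 1 then 1 else 0)"

definition block_one :: "nat \<Rightarrow> (nat \<Rightarrow> nat \<Rightarrow> real) \<Rightarrow> nat \<Rightarrow> nat \<Rightarrow> real" where
  "block_one n A r s =
     (if r \<le> n \<and> s \<le> n then A r s else if r = n + 1 \<and> s = n + 1 then 1 else 0)"

definition labelled_matrix ::
    "nat \<Rightarrow> (nat \<Rightarrow> 'm) \<Rightarrow> (nat \<Rightarrow> nat \<Rightarrow> real) \<Rightarrow> real ^ 'm ^ 'm::finite" where
  "labelled_matrix n c A =
     (\<chi> r s. A (inv_into {1..n+1} c r) (inv_into {1..n+1} c s))"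

definition circular_shift :: "nat \<Rightarrow> (nat \<Rightarrow> 'm) \<Rightarrow> nat \<Rightarrow> real ^ 'm ^ 'm::finite" where
  "circular_shift n c j = labelled_matrix n c (shift_entries (n + 1) j)"

definition circular_shifts :: "nat \<Rightarrow> (nat \<Rightarrow> 'm) \<Rightarrow> (real ^ 'm ^ 'm::finite) set" where
  "circular_shifts n c = circular_shift n c ` {0..n}"

text \<open>
  The cyclic difference \<open>i - j\<close> of two indices in \<open>{1..n+1}\<close>; it lies in \<open>{1..n}\<close> if \<open>i \<noteq> j\<close>.
  The matrix that maps \<open>rhombic_face n c 1 (n+1)\<close> to \<open>rhombic_face n c i j\<close> rotates the first \<open>n\<close>
  coordinates by \<open>cyclic_diff n i j - 1\<close>. With the integer difference, i.e. with
  \<open>(i - j - 1) mod n\<close>, this is right for \<open>j < i\<close> but wrong for all \<open>i < j\<close> if \<open>n \<ge> 2\<close>: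
  for \<open>n = 2\<close>, \<open>i = 1\<close>, \<open>j = 3\<close> it swaps the first two coordinates, while the identity is needed.
\<close>

definition cyclic_diff :: "nat \<Rightarrow> nat \<Rightarrow> nat \<Rightarrow> nat" where
  "cyclic_diff n i j = nat ((int i - int j) mod int (n + 1))"

definition congruent_sets :: "'a::metric_space set \<Rightarrow> 'a set \<Rightarrow> bool" where
  "congruent_sets A B \<longleftrightarrow> (\<exists>f. (\<forall>x y. dist (f x) (f y) = dist x y) \<and> f ` A = B)"

definition parallelepiped_on :: "'a::euclidean_space \<Rightarrow> 'a set \<Rightarrow> 'a set" where
  "parallelepiped_on a B = {a + (\<Sum>b \<in> B. t b *\<^sub>R b) | t. \<forall>b \<in> B. 0 \<le> t b \<and> t b \<le> 1}"

definition parallelepiped :: "nat \<Rightarrow> 'a::euclidean_space set \<Rightarrow> bool" where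
  "parallelepiped m P \<longleftrightarrow> (\<exists>a B. independent B \<and> card B = m \<and> P = parallelepiped_on a B)"

definition rhombus :: "'a::euclidean_space set \<Rightarrow> bool" where
  "rhombus P \<longleftrightarrow>
     (\<exists>a u v. u \<noteq> v \<and> independent {u, v} \<and> norm u = norm v \<and> P = parallelepiped_on a {u, v})"

text \<open>
  Dimension 2 is the base case. In dimensions 0 and 1, where the notion has no content, points and
  nondegenerate segments count as hyper-rhombi; the recursion never gets there from above.
\<close>

fun hyper_rhombus :: "nat \<Rightarrow> 'a::euclidean_space set \<Rightarrow> bool" where
  "hyper_rhombus 0 P \<longleftrightarrow> parallelepiped 0 P"
| "hyper_rhombus (Suc 0) P \<longleftrightarrow> parallelepiped 1 P"
| "hyper_rhombus (Suc (Suc 0)) P \<longleftrightarrow> rhombus P"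
| "hyper_rhombus (Suc (Suc (Suc m))) P \<longleftrightarrow>
     parallelepiped (Suc (Suc (Suc m))) P \<and>
     (\<forall>F. F facet_of P \<longrightarrow> hyper_rhombus (Suc (Suc m)) F) \<and>
     (\<forall>F G. F facet_of P \<longrightarrow> G facet_of P \<longrightarrow> congruent_sets F G)"

text \<open>Boundaries of the pieces are relative to their affine hulls.\<close>

definition composed_of :: "'a::euclidean_space set \<Rightarrow> 'a set set \<Rightarrow> bool" where
  "composed_of X \<P> \<longleftrightarrow>
     \<Union>\<P> = X \<and>
     (\<forall>A \<in> \<P>. \<forall>B \<in> \<P>. A \<noteq> B \<longrightarrow> A \<inter> B \<subseteq> rel_frontier A \<inter> rel_frontier B)"

definition bisecting_hyperplane ::
    "real ^ 'm::finite \<Rightarrow> real ^ 'm \<Rightarrow> (real ^ 'm) set" where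
  "bisecting_hyperplane p q = {x \<in> H_space. (x - midpoint p q) \<bullet> (q - p) = 0}"

definition nearest_neighbor :: "real ^ 'm::finite \<Rightarrow> bool" where
  "nearest_neighbor q \<longleftrightarrow>
     q \<in> A_lattice - {0} \<and> (\<forall>p :: real ^ 'm. p \<in> A_lattice - {0} \<longrightarrow> norm q \<le> norm p)"

text \<open>
  The members of \<open>C\<close> that share the edge from \<open>a\<close> to \<open>b\<close>. If \<open>a \<noteq> b\<close>, the face relation below is
  \<^const>\<open>edge_of\<close>; for \<open>n = 1\<close> the edge in question degenerates to a point.
\<close>

definition sharing_edge ::
    "'a::euclidean_space set set \<Rightarrow> 'a \<Rightarrow> 'a \<Rightarrow> 'a set set" where
  "sharing_edge C a b = {S \<in> C. closed_segment a b face_of S}"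

end

theory Submission
  imports Defs
begin

text \<open>
  The Voronoi cell is cut out of \<open>H\<close> by the inequalities \<open>x_p - x_q \<le> 1\<close>, one for each root
  \<open>e_p - e_q\<close>. Hence its boundary is the union of the faces \<open>x_p - x_q = 1\<close>, on which \<open>x_p\<close> is a
  largest and \<open>x_q\<close> a smallest coordinate; reading off the values \<open>x_k - x_q\<close> for the remaining \<open>k\<close>
  identifies such a face with the parallelepiped spanned by the \<open>\<xi>_k\<close>. These generators have equal
  norms and equal mutual inner products, so a reflection swaps any two of them and fixes the others,
  which makes the facets congruent. Permutation matrices permute the faces. The images of
  the roof are the sets of points of such a face whose coordinates are sorted in a prescribed order,
  and sorting the coordinates of a point tells in which image it lies.
\<close>

section \<open>Faces and parallelepipeds\<close>

text \<open>That the listed faces are all faces of their dimension, both for the Voronoi cell and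
  for a parallelepiped, has one common reason. Take a relative interior point of a face. If no
  defining inequality is tight there, the point can be pushed slightly away from any other point of
  the set, so the face is the whole set by \<open>face_of_eq_if_extendable\<close>, against its
  dimension. Otherwise a listed face passes through the point, and equal dimensions force the two to
  agree. Constants are avoided throughout: projecting to \<open>H_space\<close> shifts all
  coordinates of a combination of the \<open>xi\<close> by the same amount, so points are compared
  through differences of coordinates, and \<open>H_space_eqI\<close> absorbs the shift. The geometry
  is stated for elements of the index type. A labelling enters only through numbered objects such as
  the shift matrices and the roof; since the facts about the roof hold for every enumeration, they
  apply to each of its images as well.\<close>

lemma face_of_eq_if_extendable:
  fixes S :: "'a::real_vector set"
  assumes F: "F face_of S" and x: "x \<in> F"
    and ext: "\<And>y. y \<in> S \<Longrightarrow> \<exists>e>0. x + e *\<^sub>R (x - y) \<in> S"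
  shows "F = S"
proof
  show "F \<subseteq> S" using F by (rule face_of_imp_subset)
  show "S \<subseteq> F"
  proof
    fix y assume y: "y \<in> S"
    show "y \<in> F"
    proof (cases "y = x")
      case False
      obtain e where e: "e > 0" and z: "x + e *\<^sub>R (x - y) \<in> S" using ext y by blast
      \<comment> \<open>Solving \<open>x = (1 - u) y + u (x + e (x - y))\<close> for the weight
        gives \<open>u = 1 / (1 + e)\<close>. Thus \<open>x\<close> lies strictly between two points
        of \<open>S\<close>, and a face containing \<open>x\<close> must contain both.\<close>
      have "x = (1 - 1 / (1 + e)) *\<^sub>R y + (1 / (1 + e)) *\<^sub>R (x + e *\<^sub>R (x - y))"
      proof -
        have "(1 / (1 + e)) *\<^sub>R (x + e *\<^sub>R (x - y))
            = (1 / (1 + e)) *\<^sub>R ((1 + e) *\<^sub>R x - e *\<^sub>R y)"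
          by (simp add: algebra_simps)
        also have "\<dots> = x - (e / (1 + e)) *\<^sub>R y"
          using e by (simp add: scaleR_diff_right)
        moreover have "1 - 1 / (1 + e) = e / (1 + e)" using e by (simp add: field_simps)
        ultimately show ?thesis by simp
      qed
      moreover have "y \<noteq> x + e *\<^sub>R (x - y)"
      proof
        assume "y = x + e *\<^sub>R (x - y)"
        then have "(1 + e) *\<^sub>R (x - y) = 0" by (simp add: algebra_simps)
        then show False using False e by simp
      qed
      ultimately have "x \<in> open_segment y (x + e *\<^sub>R (x - y))"
        unfolding in_segment using e by (intro conjI exI[of _ "1 / (1 + e)"]) auto
      then show ?thesis using F x y z unfolding face_of_def by blast
    qed (use x in simp)
  qed
qed

text \<open>A face that meets the relative interior of \<open>F\<close> swallows all of
  \<open>F\<close>. Then \<open>F\<close> is a face of \<open>T\<close>, and a proper face would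
  have smaller dimension.\<close>

lemma facet_eq_if_meets_rel_interior:
  fixes S :: "'a::euclidean_space set"
  assumes "convex S" "F face_of S" "T face_of S" "x \<in> rel_interior F" "x \<in> T"
    and "aff_dim F = aff_dim T"
  shows "F = T"
proof -
  have "F \<subseteq> T"
    using subset_of_face_of[OF assms(3) face_of_imp_subset[OF assms(2)]] assms(4,5) by blast
  then have "F face_of T"
    using face_of_subset[OF assms(2) _ face_of_imp_subset[OF assms(3)]] by simp
  then show ?thesis
    using face_of_aff_dim_lt[of T F] assms(3,6) face_of_imp_convex by force
qed

section \<open>Parallelepipeds and their facets\<close>

lemma parallelepiped_on_translation:
  "parallelepiped_on a B = (+) a ` parallelepiped_on 0 B"
  unfolding parallelepiped_on_def by auto

lemma base_in_parallelepiped_on: "a \<in> parallelepiped_on a B"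
  unfolding parallelepiped_on_def by (auto intro!: exI[of _ "\<lambda>_. 0"])

lemma convex_parallelepiped_on: "convex (parallelepiped_on a B)"
proof (rule convexI)
  fix x y :: 'a and u v :: real
  assume "x \<in> parallelepiped_on a B" "y \<in> parallelepiped_on a B" and uv: "0 \<le> u" "0 \<le> v" "u + v = 1"
  then obtain s t where
    s: "x = a + (\<Sum>b\<in>B. s b *\<^sub>R b)" "\<forall>b\<in>B. 0 \<le> s b \<and> s b \<le> 1" and
    t: "y = a + (\<Sum>b\<in>B. t b *\<^sub>R b)" "\<forall>b\<in>B. 0 \<le> t b \<and> t b \<le> 1"
    unfolding parallelepiped_on_def by blast
  have "u *\<^sub>R x + v *\<^sub>R y = (u + v) *\<^sub>R a + (\<Sum>b\<in>B. (u * s b + v * t b) *\<^sub>R b)"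
    unfolding s t by (simp add: algebra_simps sum.distrib scaleR_sum_right)
  moreover have "0 \<le> u * s b + v * t b" "u * s b + v * t b \<le> 1" if "b \<in> B" for b
    using that s(2) t(2) uv convex_bound_le[of "s b" 1 "t b" u v] by auto
  ultimately show "u *\<^sub>R x + v *\<^sub>R y \<in> parallelepiped_on a B"
    unfolding parallelepiped_on_def using uv(3)
    by (auto intro!: exI[of _ "\<lambda>b. u * s b + v * t b"])
qed

text \<open>With base point 0 the set lies between \<open>B\<close> and \<open>span B\<close> and
  contains 0, so its affine dimension is the linear dimension of \<open>span B\<close>.\<close>

lemma aff_dim_parallelepiped_on:
  assumes "independent B"
  shows "aff_dim (parallelepiped_on a B) = int (card B)"
proof -
  let ?P = "parallelepiped_on 0 B"
  have fin: "finite B" using assms by (rule independent_imp_finite)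
  have "B \<subseteq> ?P"
  proof
    fix b assume "b \<in> B"
    then have "(\<Sum>b'\<in>B. (if b' = b then 1 else 0) *\<^sub>R b') = b"
      using fin by (simp add: if_distrib[of "\<lambda>r. r *\<^sub>R _"] cong: if_cong)
    then show "b \<in> ?P"
      unfolding parallelepiped_on_def by (auto intro!: exI[of _ "\<lambda>b'. if b' = b then 1 else 0"])
  qed
  moreover have "?P \<subseteq> span B"
    unfolding parallelepiped_on_def by (auto intro: span_sum span_scale span_base)
  ultimately have "span ?P = span B"
    by (meson span_mono span_minimal subspace_span subset_antisym)
  then have "dim ?P = card B"
    by (metis dim_eq_card_independent[OF assms] dim_span)
  moreover have "aff_dim ?P = int (dim ?P)"
    using base_in_parallelepiped_on by (intro aff_dim_zero hull_inc)
  ultimately show ?thesis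
    by (subst parallelepiped_on_translation) (simp add: aff_dim_translation_eq)
qed

lemma linear_image_parallelepiped_on:
  assumes "linear f" "inj_on f B"
  shows "f ` parallelepiped_on a B = parallelepiped_on (f a) (f ` B)"
proof
  show "f ` parallelepiped_on a B \<subseteq> parallelepiped_on (f a) (f ` B)"
  proof
    fix y assume "y \<in> f ` parallelepiped_on a B"
    then obtain t where t: "\<forall>b\<in>B. 0 \<le> t b \<and> t b \<le> 1" "y = f (a + (\<Sum>b\<in>B. t b *\<^sub>R b))"
      unfolding parallelepiped_on_def by blast
    let ?s = "\<lambda>b. t (inv_into B f b)"
    have "y = f a + (\<Sum>b\<in>f ` B. ?s b *\<^sub>R b)"
      using assms t(2)
      by (simp add: sum.reindex linear_add linear_sum linear_scale)
    moreover have "\<forall>b\<in>f ` B. 0 \<le> ?s b \<and> ?s b \<le> 1" using t(1) assms(2) by simp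
    ultimately show "y \<in> parallelepiped_on (f a) (f ` B)"
      unfolding parallelepiped_on_def by (intro CollectI exI[of _ ?s] conjI)
  qed
  show "parallelepiped_on (f a) (f ` B) \<subseteq> f ` parallelepiped_on a B"
  proof
    fix y assume "y \<in> parallelepiped_on (f a) (f ` B)"
    then obtain t where t: "\<forall>b\<in>f ` B. 0 \<le> t b \<and> t b \<le> 1" "y = f a + (\<Sum>b\<in>f ` B. t b *\<^sub>R b)"
      unfolding parallelepiped_on_def by blast
    have "y = f (a + (\<Sum>b\<in>B. t (f b) *\<^sub>R b))"
      using assms t(2) by (simp add: sum.reindex linear_add linear_sum linear_scale)
    then show "y \<in> f ` parallelepiped_on a B"
      unfolding parallelepiped_on_def using t(1) by (intro image_eqI) auto
  qed
qed

text \<open>The inner product with \<open>w\<close> reads off the coefficient of \<open>b\<close>;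
  this makes \<open>w\<close> the normal of the hyperplanes that carry two opposite facets. It
  represents the coordinate functional, extended linearly to the whole space.\<close>

lemma independent_dual_vector:
  fixes B :: "'a::euclidean_space set"
  assumes "independent B" "b \<in> B"
  obtains w where "w \<bullet> b = 1" "\<And>b'. b' \<in> B \<Longrightarrow> b' \<noteq> b \<Longrightarrow> w \<bullet> b' = 0"
proof -
  obtain f :: "'a \<Rightarrow> real" where f: "linear f" "\<And>x. x \<in> B \<Longrightarrow> f x = (if x = b then 1 else 0)"
    using linear_independent_extend[OF assms(1), of "\<lambda>x. if x = b then 1 else 0"] by metis
  have "adjoint f 1 \<bullet> x = f x" for x
  proof -
    have "x \<bullet> adjoint f 1 = f x \<bullet> 1" using f(1) by (rule adjoint_works)
    then show ?thesis by (simp only: inner_commute[of x] inner_real_def mult_1_right)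
  qed
  note w = this
  show ?thesis
  proof (rule that)
    show "adjoint f 1 \<bullet> b = 1" unfolding w using f(2)[of b] assms(2) by simp
    show "adjoint f 1 \<bullet> b' = 0" if "b' \<in> B" "b' \<noteq> b" for b'
      unfolding w using f(2)[of b'] that by simp
  qed
qed

text \<open>The two facets across \<open>b\<close> are where the coefficient of \<open>b\<close>,
  measured by a dual vector, attains its minimum 0 and its maximum 1. On the right-hand sides the
  sum and the quantifier rebind \<open>b\<close>; only the last conjunct \<open>t b = 0\<close> or
  \<open>t b = 1\<close> speaks of the fixed generator.\<close>

lemma parallelepiped_on_facets:
  fixes B :: "'a::euclidean_space set"
  assumes B: "independent B" and b: "b \<in> B"
  shows "parallelepiped_on a (B - {b}) = {x \<in> parallelepiped_on a B. \<exists>t. x = a + (\<Sum>b\<in>B. t b *\<^sub>R b)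
           \<and> (\<forall>b\<in>B. 0 \<le> t b \<and> t b \<le> 1) \<and> t b = 0}" (is "?Lz = ?Rz")
    and "parallelepiped_on (a + b) (B - {b}) = {x \<in> parallelepiped_on a B. \<exists>t. x = a + (\<Sum>b\<in>B. t b *\<^sub>R b)
           \<and> (\<forall>b\<in>B. 0 \<le> t b \<and> t b \<le> 1) \<and> t b = 1}" (is "?Lo = ?Ro")
    and "parallelepiped_on a (B - {b}) face_of parallelepiped_on a B"
    and "parallelepiped_on (a + b) (B - {b}) face_of parallelepiped_on a B"
proof -
  have fin: "finite B" using B by (rule independent_imp_finite)
  have split: "(\<Sum>b\<in>B. t b *\<^sub>R b) = t b *\<^sub>R b + (\<Sum>b\<in>B - {b}. t b *\<^sub>R b)" for t
    using fin b by (rule sum.remove)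
  have split': "(\<Sum>b'\<in>B. (t(b := r)) b' *\<^sub>R b') = r *\<^sub>R b + (\<Sum>b\<in>B - {b}. t b *\<^sub>R b)" for t r
    unfolding split by (auto intro!: sum.cong)
  \<comment> \<open>One computation for a general level \<open>r\<close> of the coefficient;
    \<open>r = 0\<close> and \<open>r = 1\<close> give the two facets.\<close>
  have *: "parallelepiped_on (a + r *\<^sub>R b) (B - {b}) = {x \<in> parallelepiped_on a B. \<exists>t. x = a + (\<Sum>b\<in>B. t b *\<^sub>R b)
           \<and> (\<forall>b\<in>B. 0 \<le> t b \<and> t b \<le> 1) \<and> t b = r}" (is "?L = ?R") if r: "0 \<le> r" "r \<le> 1" for r
  proof
    show "?L \<subseteq> ?R"
    proof
      fix x assume "x \<in> ?L"
      then obtain t where t: "\<forall>b\<in>B - {b}. 0 \<le> t b \<and> t b \<le> 1"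
          "x = a + r *\<^sub>R b + (\<Sum>b\<in>B - {b}. t b *\<^sub>R b)"
        unfolding parallelepiped_on_def by blast
      have "x = a + (\<Sum>b'\<in>B. (t(b := r)) b' *\<^sub>R b')" unfolding split' t(2) by (simp add: add.assoc)
      moreover have "\<forall>b'\<in>B. 0 \<le> (t(b := r)) b' \<and> (t(b := r)) b' \<le> 1" using t(1) r by auto
      moreover have "(t(b := r)) b = r" by simp
      ultimately show "x \<in> ?R" unfolding parallelepiped_on_def by blast
    qed
    show "?R \<subseteq> ?L"
      unfolding parallelepiped_on_def split by (auto simp: add.assoc)
  qed
  show R0: "?Lz = ?Rz" using *[of 0] by simp
  show R1: "?Lo = ?Ro" using *[of 1] by simp
  obtain w where w: "w \<bullet> b = 1" "\<And>b'. b' \<in> B \<Longrightarrow> b' \<noteq> b \<Longrightarrow> w \<bullet> b' = 0"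
    using independent_dual_vector[OF B b] by blast
  have wt: "w \<bullet> (a + (\<Sum>b\<in>B. t b *\<^sub>R b)) = w \<bullet> a + t b" for t
    unfolding split using w by (simp add: inner_add_right inner_sum_right)
  have eqz: "?Rz = parallelepiped_on a B \<inter> {x. w \<bullet> x = w \<bullet> a}"
    unfolding parallelepiped_on_def using wt by auto
  have boundz: "w \<bullet> x \<ge> w \<bullet> a" if "x \<in> parallelepiped_on a B" for x
    using that b unfolding parallelepiped_on_def by (auto simp: wt)
  show "?Lz face_of parallelepiped_on a B"
    unfolding R0 eqz using boundz
    by (rule face_of_Int_supporting_hyperplane_ge[OF convex_parallelepiped_on])
  have eqo: "?Ro = parallelepiped_on a B \<inter> {x. w \<bullet> x = w \<bullet> a + 1}"
    unfolding parallelepiped_on_def using wt by auto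
  have boundo: "w \<bullet> x \<le> w \<bullet> a + 1" if "x \<in> parallelepiped_on a B" for x
    using that b unfolding parallelepiped_on_def by (auto simp: wt)
  show "?Lo face_of parallelepiped_on a B"
    unfolding R1 eqo using boundo
    by (rule face_of_Int_supporting_hyperplane_le[OF convex_parallelepiped_on])
qed

text \<open>Finitely many strict inequalities survive a small enough perturbation. The filter yields
  a common step length without taking a minimum over the inequalities.\<close>

lemma eventually_strict_at_right:
  fixes a b :: real
  assumes "0 < a"
  shows "\<forall>\<^sub>F e in at_right 0. 0 < a + e * b"
proof (rule order_tendstoD)
  show "((\<lambda>e. a + e * b) \<longlongrightarrow> a + 0 * b) (at_right 0)" by (intro tendsto_intros)
  show "0 < a + 0 * b" using assms by simp
qed

lemma facet_of_parallelepiped_on: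
  fixes B :: "'a::euclidean_space set"
  assumes B: "independent B" and F: "F facet_of parallelepiped_on a B"
  shows "\<exists>b\<in>B. F = parallelepiped_on a (B - {b}) \<or> F = parallelepiped_on (a + b) (B - {b})"
proof -
  let ?P = "parallelepiped_on a B"
  have fin: "finite B" using B by (rule independent_imp_finite)
  have Ff: "F face_of ?P" and ne: "F \<noteq> {}" and dimF: "aff_dim F = int (card B) - 1"
    using F aff_dim_parallelepiped_on[OF B] unfolding facet_of_def by auto
  obtain x where x: "x \<in> rel_interior F"
    using ne rel_interior_eq_empty face_of_imp_convex[OF Ff] by blast
  have xF: "x \<in> F" using x rel_interior_subset by blast
  then have "x \<in> ?P" using Ff face_of_imp_subset by blast
  then obtain t where t: "\<forall>b\<in>B. 0 \<le> t b \<and> t b \<le> 1" "x = a + (\<Sum>b\<in>B. t b *\<^sub>R b)"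
    unfolding parallelepiped_on_def by blast
  have "\<exists>b\<in>B. t b = 0 \<or> t b = 1"
  proof (rule ccontr)
    assume "\<not> ?thesis"
    then have strict: "0 < t b" "0 < 1 - t b" if "b \<in> B" for b using t(1) that by force+
    have "F = ?P"
    proof (rule face_of_eq_if_extendable[OF Ff xF])
      fix y assume "y \<in> ?P"
      then obtain s where s: "y = a + (\<Sum>b\<in>B. s b *\<^sub>R b)" unfolding parallelepiped_on_def by blast
      \<comment> \<open>The coefficient of \<open>b\<close> in \<open>x + e (x - y)\<close> is
        \<open>t b + e * (t b - s b)\<close>. The first inequality keeps it above 0, the second
        keeps it below 1.\<close>
      have "\<forall>\<^sub>F e in at_right 0. \<forall>b\<in>B. 0 < t b + e * (t b - s b) \<and> 0 < (1 - t b) + e * (s b - t b)"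
        using fin strict by (intro eventually_ball_finite ballI eventually_conj eventually_strict_at_right)
      moreover have "\<forall>\<^sub>F e in at_right 0. (0::real) < e" by (rule eventually_at_right_less)
      ultimately have "\<forall>\<^sub>F e in at_right 0. 0 < e \<and>
          (\<forall>b\<in>B. 0 < t b + e * (t b - s b) \<and> 0 < (1 - t b) + e * (s b - t b))"
        by (rule eventually_conj[rotated])
      then obtain e where e: "0 < e"
          "\<forall>b\<in>B. 0 < t b + e * (t b - s b) \<and> 0 < (1 - t b) + e * (s b - t b)"
        using eventually_happens[of _ "at_right (0::real)"] by auto
      have "x + e *\<^sub>R (x - y) = a + (\<Sum>b\<in>B. (t b + e * (t b - s b)) *\<^sub>R b)"
        unfolding t s by (simp add: algebra_simps sum.distrib sum_subtractf scaleR_sum_right)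
      moreover have "\<forall>b\<in>B. 0 \<le> t b + e * (t b - s b) \<and> t b + e * (t b - s b) \<le> 1"
        using e(2) by (force simp: algebra_simps)
      ultimately have "x + e *\<^sub>R (x - y) \<in> ?P"
        unfolding parallelepiped_on_def
        by (auto intro!: exI[of _ "\<lambda>b. t b + e * (t b - s b)"])
      then show "\<exists>e>0. x + e *\<^sub>R (x - y) \<in> ?P" using e(1) by blast
    qed
    then show False using dimF aff_dim_parallelepiped_on[OF B, of a] by simp
  qed
  then obtain b where b: "b \<in> B" "t b = 0 \<or> t b = 1" by blast
  have dim: "aff_dim (parallelepiped_on a' (B - {b})) = int (card B) - 1" for a'
  proof -
    have "card B > 0" using fin b(1) card_gt_0_iff by blast
    moreover have "independent (B - {b})" using B by (rule independent_mono) auto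
    ultimately show ?thesis
      using aff_dim_parallelepiped_on[of "B - {b}" a'] fin b(1) by (simp add: of_nat_diff)
  qed
  have "x \<in> parallelepiped_on a (B - {b}) \<or> x \<in> parallelepiped_on (a + b) (B - {b})"
    using b t \<open>x \<in> ?P\<close> unfolding parallelepiped_on_facets(1,2)[OF B b(1), where a = a] by blast
  then show ?thesis
    using facet_eq_if_meets_rel_interior[OF convex_parallelepiped_on Ff _ x]
      parallelepiped_on_facets(3,4)[OF B b(1)] dimF dim b(1) by metis
qed

text \<open>The base points may be arbitrary because the linear reflection is followed by a
  translation. Taking \<open>b = b'\<close> covers two opposite facets.\<close>

lemma congruent_facets:
  fixes B :: "'a::euclidean_space set"
  assumes nrm: "\<And>b b'. b \<in> B \<Longrightarrow> b' \<in> B \<Longrightarrow> norm b = norm b'"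
    and inn: "\<And>b b' d d'. b \<in> B \<Longrightarrow> b' \<in> B \<Longrightarrow> d \<in> B \<Longrightarrow> d' \<in> B \<Longrightarrow> b \<noteq> b' \<Longrightarrow> d \<noteq> d' \<Longrightarrow> b \<bullet> b' = d \<bullet> d'"
    and b: "b \<in> B" "b' \<in> B"
  shows "congruent_sets (parallelepiped_on a (B - {b})) (parallelepiped_on a' (B - {b'}))"
proof -
  define w where "w = b - b'"
  \<comment> \<open>Reflection that swaps \<open>b\<close> and \<open>b'\<close>; for \<open>b = b'\<close> it is the identity, since \<open>x / 0 = 0\<close>.\<close>
  define R where "R x = x - (2 * (x \<bullet> w) / (w \<bullet> w)) *\<^sub>R w" for x
  have lin: "linear R"
    unfolding R_def
    by (intro linearI) (simp_all add: algebra_simps inner_add_left add_divide_distrib)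
  have nR: "norm (R x) = norm x" for x
  proof -
    have "R x \<bullet> R x = x \<bullet> x"
    proof (cases "w = 0")
      case False
      define q where "q = x \<bullet> w / (w \<bullet> w)"
      have q: "q * (w \<bullet> w) = x \<bullet> w" using False unfolding q_def by simp
      have "R x = x - (2 * q) *\<^sub>R w" unfolding R_def q_def by simp
      then have "R x \<bullet> R x = x \<bullet> x - 4 * q * (x \<bullet> w) + 4 * q * (q * (w \<bullet> w))"
        using inner_commute[of w x]
        by (simp only: inner_diff_left inner_diff_right inner_scaleR_left inner_scaleR_right)
          (simp add: algebra_simps)
      then show ?thesis unfolding q by simp
    qed (simp add: R_def)
    then show ?thesis by (simp add: norm_eq_sqrt_inner)
  qed
  have nn: "b \<bullet> b = b' \<bullet> b'" using nrm[OF b] by (simp add: norm_eq_sqrt_inner)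
  have Rb: "R b = b'"
  proof (cases "b = b'")
    case False
    \<comment> \<open>Equal norms make \<open>b + b'\<close> orthogonal to
      \<open>w = b - b'\<close>.\<close>
    have "w \<bullet> w = 2 * (b \<bullet> w)"
      unfolding w_def using nn by (simp add: inner_diff_left inner_diff_right inner_commute)
    moreover have "w \<bullet> w \<noteq> 0" using False unfolding w_def by simp
    ultimately have "2 * (b \<bullet> w) / (w \<bullet> w) = 1" by (metis divide_self)
    then have "R b = b - 1 *\<^sub>R w" unfolding R_def by (simp only:)
    then show ?thesis by (simp add: w_def)
  qed (simp add: R_def w_def)
  have Rb': "R b' = b"
  proof (cases "b = b'")
    case False
    have "2 * (b' \<bullet> w) = - (w \<bullet> w)"
      unfolding w_def using nn by (simp add: inner_diff_left inner_diff_right inner_commute)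
    moreover have "w \<bullet> w \<noteq> 0" using False unfolding w_def by simp
    ultimately have "2 * (b' \<bullet> w) / (w \<bullet> w) = - 1" by (metis divide_self minus_divide_left)
    then have "R b' = b' - (- 1) *\<^sub>R w" unfolding R_def by (simp only:)
    then show ?thesis by (simp add: w_def)
  qed (simp add: R_def w_def)
  \<comment> \<open>Equal inner products with \<open>b\<close> and \<open>b'\<close> put
    \<open>d\<close> into the mirror hyperplane orthogonal to \<open>w\<close>.\<close>
  have Rd: "R d = d" if "d \<in> B" "d \<noteq> b" "d \<noteq> b'" for d
    using inn[of d b d b'] that b unfolding R_def w_def by (simp add: inner_diff_right)
  have inj: "inj R"
  proof (rule injI)
    fix x y assume "R x = R y"
    then have "R (x - y) = 0" using lin by (simp add: linear_diff)
    then show "x = y" using nR[of "x - y"] by simp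
  qed
  have RB: "R ` (B - {b}) = B - {b'}"
  proof
    show sub: "R ` (B - {b}) \<subseteq> B - {b'}"
    proof
      fix y assume "y \<in> R ` (B - {b})"
      then obtain d where d: "d \<in> B" "d \<noteq> b" "y = R d" by blast
      show "y \<in> B - {b'}" using d b Rb' Rd by (cases "d = b'") auto
    qed
    show "B - {b'} \<subseteq> R ` (B - {b})"
    proof
      fix d assume d: "d \<in> B - {b'}"
      show "d \<in> R ` (B - {b})"
      proof (cases "d = b")
        case True
        then show ?thesis using d b Rb' by (intro image_eqI[of _ _ b']) auto
      next
        case False
        then show ?thesis using d Rd by (intro image_eqI[of _ _ d]) auto
      qed
    qed
  qed
  let ?f = "\<lambda>x. (a' - R a) + R x"
  have "dist (?f x) (?f y) = dist x y" for x y
    using nR[of "x - y"] lin by (simp add: dist_norm linear_diff)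
  moreover have "?f ` parallelepiped_on a (B - {b}) = parallelepiped_on a' (B - {b'})"
  proof -
    have "?f ` parallelepiped_on a (B - {b}) = (+) (a' - R a) ` R ` parallelepiped_on a (B - {b})"
      by (simp add: image_image)
    also have "R ` parallelepiped_on a (B - {b}) = parallelepiped_on (R a) (B - {b'})"
      using linear_image_parallelepiped_on[OF lin inj_on_subset[OF inj]] RB by simp
    also have "(+) (a' - R a) ` parallelepiped_on (R a) (B - {b'}) = parallelepiped_on a' (B - {b'})"
      unfolding parallelepiped_on_translation[of "R a"] parallelepiped_on_translation[of a']
      by (simp add: image_image)
    finally show ?thesis .
  qed
  ultimately show ?thesis unfolding congruent_sets_def by (intro exI[of _ ?f] conjI allI)
qed

text \<open>The conditions on norms and inner products pass to subsets of \<open>B\<close>. Each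
  facet is spanned by some \<open>B - {b}\<close>, so the induction hypothesis applies to it, and
  \<open>congruent_facets\<close> compares any two facets.\<close>

lemma hyper_rhombus_parallelepiped_on:
  fixes B :: "'a::euclidean_space set"
  assumes "independent B" "card B = m"
    and "\<And>b b'. b \<in> B \<Longrightarrow> b' \<in> B \<Longrightarrow> norm b = norm b'"
    and "\<And>b b' d d'. b \<in> B \<Longrightarrow> b' \<in> B \<Longrightarrow> d \<in> B \<Longrightarrow> d' \<in> B \<Longrightarrow> b \<noteq> b' \<Longrightarrow> d \<noteq> d' \<Longrightarrow> b \<bullet> b' = d \<bullet> d'"
  shows "hyper_rhombus m (parallelepiped_on a B)"
  using assms
proof (induction m arbitrary: a B rule: less_induct)
  case (less m)
  have para: "parallelepiped m (parallelepiped_on a B)"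
    unfolding parallelepiped_def using less.prems(1,2) by blast
  consider "m = 0" | "m = 1" | "m = 2" | k where "m = Suc (Suc (Suc k))"
    by (metis One_nat_def Suc_1 not0_implies_Suc)
  then show ?case
  proof cases
    case 3
    then obtain u v where "B = {u, v}" "u \<noteq> v"
      using less.prems(2) by (auto simp: card_2_iff)
    then have "rhombus (parallelepiped_on a B)"
      unfolding rhombus_def using less.prems(1,3) by blast
    then show ?thesis using 3 by (simp add: numeral_2_eq_2)
  next
    case 4
    have "hyper_rhombus (Suc (Suc k)) F" if FP: "F facet_of parallelepiped_on a B" for F
    proof -
      obtain b a' where b: "b \<in> B" "F = parallelepiped_on a' (B - {b})"
        using facet_of_parallelepiped_on[OF less.prems(1) FP] by blast
      have "card (B - {b}) = Suc (Suc k)" using b(1) less.prems(2) 4 by simp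
      moreover have "independent (B - {b})" using less.prems(1) by (rule independent_mono) auto
      ultimately show ?thesis
        unfolding b(2) using less.prems(3,4) 4 by (intro less.IH) auto
    qed
    moreover have "congruent_sets F G"
      if FG: "F facet_of parallelepiped_on a B" "G facet_of parallelepiped_on a B" for F G
    proof -
      obtain b a' where b: "b \<in> B" "F = parallelepiped_on a' (B - {b})"
        using facet_of_parallelepiped_on[OF less.prems(1) FG(1)] by blast
      obtain d a'' where d: "d \<in> B" "G = parallelepiped_on a'' (B - {d})"
        using facet_of_parallelepiped_on[OF less.prems(1) FG(2)] by blast
      show ?thesis unfolding b(2) d(2)
        using congruent_facets[OF less.prems(3,4) b(1) d(1)] by blast
    qed
    ultimately show ?thesis using 4 para by simp
  qed (use para in simp_all)
qed

section \<open>The Voronoi cell in coordinates\<close>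

lemma H_space_iff: "x \<in> H_space \<longleftrightarrow> (\<Sum>k\<in>UNIV. x $ k) = 0"
  unfolding H_space_def all_ones_def by (simp add: inner_vec_def)

lemma subspace_H_space: "subspace (H_space :: (real ^ 'm::finite) set)"
  unfolding H_space_def by (simp add: inner_commute[of _ all_ones] subspace_hyperplane)

text \<open>A vector with constant coordinates and coordinate sum 0 vanishes. Hence it is enough to
  identify points of \<open>H_space\<close> up to a common shift of all coordinates.\<close>

lemma H_space_eqI:
  fixes x y :: "real ^ 'm::finite"
  assumes "x \<in> H_space" "y \<in> H_space" "\<And>k. x $ k - y $ k = d"
  shows "x = y"
proof -
  have "(\<Sum>k\<in>UNIV. x $ k - y $ k) = 0"
    using assms(1,2) unfolding H_space_iff by (simp add: sum_subtractf)
  then have "d = 0" using assms(3) by simp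
  then show ?thesis using assms(3) by (simp add: vec_eq_iff)
qed

lemma inner_unit_diff: "(axis p 1 - axis q 1) \<bullet> (x :: real ^ 'm::finite) = x $ p - x $ q"
  by (simp add: inner_diff_left inner_axis')

lemma unit_diff_in_A_lattice: "axis p 1 - axis q 1 \<in> (A_lattice :: (real ^ 'm::finite) set)"
  unfolding A_lattice_def H_space_iff by (auto simp: sum_subtractf axis_def)

text \<open>Since the coordinates of \<open>z\<close> sum to 0, subtracting the minimum from every
  coordinate of \<open>x\<close> does not change the inner product and moves these coordinates into
  the unit interval. For \<open>0 \<le> y \<le> 1\<close> and an integer \<open>a\<close> one has
  \<open>2 y a \<le> a^2 + a\<close>: if \<open>a \<ge> 0\<close>, use
  \<open>y a \<le> a \<le> a^2\<close>; if \<open>a \<le> -1\<close>, the left side is at most 0 and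
  the right side is at least 0. Summing over the coordinates removes the linear term.\<close>

lemma inner_lattice_le:
  fixes x z :: "real ^ 'm::finite"
  assumes z: "z \<in> A_lattice" and x: "\<And>p q. x $ p - x $ q \<le> 1"
  shows "2 * (x \<bullet> z) \<le> z \<bullet> z"
proof -
  define m where "m = Min (range (\<lambda>k. x $ k))"
  have "m \<in> range (\<lambda>k. x $ k)" unfolding m_def by (rule Min_in) auto
  then obtain q where q: "m = x $ q" by blast
  have m: "m \<le> x $ k" for k unfolding m_def by (rule Min_le) auto
  have zH: "(\<Sum>k\<in>UNIV. z $ k) = 0" using z unfolding A_lattice_def H_space_iff by simp
  have coord: "2 * ((x $ k - m) * z $ k) \<le> z $ k * z $ k + z $ k" for k
  proof -
    have y: "0 \<le> x $ k - m" "x $ k - m \<le> 1" using m x[of k q] q by auto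
    obtain i where i: "z $ k = of_int i" using z unfolding A_lattice_def by (auto elim: Ints_cases)
    have "i \<le> -1 \<or> 0 \<le> i" by arith
    then show ?thesis
    proof
      assume "0 \<le> i"
      have "0 \<le> i * (i - 1)"
        using \<open>0 \<le> i\<close> by (cases "i = 0") auto
      then have "of_int i \<le> (of_int i * of_int i :: real)"
        by (metis diff_ge_0_iff_ge mult.right_neutral of_int_le_iff of_int_mult right_diff_distrib)
      moreover have "(x $ k - m) * of_int i \<le> 1 * of_int i"
        using y \<open>0 \<le> i\<close> by (intro mult_right_mono) auto
      ultimately show ?thesis unfolding i by simp
    next
      assume "i \<le> -1"
      then have "0 \<le> i * (i + 1)" by (intro mult_nonpos_nonpos) auto
      then have "0 \<le> (of_int i * of_int i + of_int i :: real)"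
        by (metis distrib_left mult.right_neutral of_int_0_le_iff of_int_add of_int_mult)
      moreover have "(x $ k - m) * of_int i \<le> 0"
        using y \<open>i \<le> -1\<close> by (intro mult_nonneg_nonpos) auto
      ultimately show ?thesis unfolding i by simp
    qed
  qed
  have "2 * (x \<bullet> z) = 2 * (\<Sum>k\<in>UNIV. (x $ k - m) * z $ k)"
    using zH by (simp add: inner_vec_def left_diff_distrib sum_subtractf flip: sum_distrib_left)
  also have "\<dots> = (\<Sum>k\<in>UNIV. 2 * ((x $ k - m) * z $ k))" by (simp add: sum_distrib_left)
  also have "\<dots> \<le> (\<Sum>k\<in>UNIV. z $ k * z $ k + z $ k)" by (rule sum_mono) (rule coord)
  also have "\<dots> = z \<bullet> z" using zH by (simp add: sum.distrib inner_vec_def)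
  finally show ?thesis .
qed

text \<open>Squaring turns the condition for a lattice vector \<open>z\<close> into
  \<open>2 (x \<bullet> z) \<le> z \<bullet> z\<close>. For a root the right side is 2, which gives
  the listed inequality; by \<open>inner_lattice_le\<close> the roots imply the condition for all
  other lattice vectors.\<close>

lemma voronoi0_eq:
  "voronoi0 = {x \<in> (H_space :: (real ^ 'm::finite) set). \<forall>p q. x $ p - x $ q \<le> 1}"
proof -
  have le: "norm x \<le> norm (x - z) \<longleftrightarrow> 2 * (x \<bullet> z) \<le> z \<bullet> z" for x z :: "real ^ 'm"
    by (simp add: norm_le inner_diff_left inner_diff_right inner_commute)
  have "x $ p - x $ q \<le> 1" if "x \<in> voronoi0" for x :: "real ^ 'm" and p q
  proof (cases "p = q")
    case False
    have "2 * (x \<bullet> (axis p 1 - axis q 1)) \<le> (axis p 1 - axis q 1) \<bullet> (axis p 1 - axis q (1::real))"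
      using that unit_diff_in_A_lattice unfolding voronoi0_def le by blast
    then show ?thesis
      using False by (simp only: inner_commute[of x] inner_unit_diff) (simp add: axis_def)
  qed simp
  moreover have "x \<in> voronoi0"
    if "x \<in> H_space" "\<forall>p q. x $ p - x $ q \<le> 1" for x :: "real ^ 'm"
    using that inner_lattice_le unfolding voronoi0_def le by blast
  ultimately show ?thesis unfolding voronoi0_def by blast
qed

lemma convex_voronoi0: "convex (voronoi0 :: (real ^ 'm::finite) set)"
proof (rule convexI)
  fix x y :: "real ^ 'm" and u v :: real
  assume "x \<in> voronoi0" "y \<in> voronoi0" and uv: "0 \<le> u" "0 \<le> v" "u + v = 1"
  then have x: "x \<in> H_space" "\<And>p q. x $ p - x $ q \<le> 1" and y: "y \<in> H_space" "\<And>p q. y $ p - y $ q \<le> 1"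
    unfolding voronoi0_eq by auto
  have "(u *\<^sub>R x + v *\<^sub>R y) $ p - (u *\<^sub>R x + v *\<^sub>R y) $ q \<le> 1" for p q
    using convex_bound_le[OF x(2)[of p q] y(2)[of p q] uv] by (simp add: algebra_simps)
  then show "u *\<^sub>R x + v *\<^sub>R y \<in> voronoi0"
    unfolding voronoi0_eq using x(1) y(1) subspace_H_space
    by (auto intro!: subspace_add subspace_scale)
qed

text \<open>The rhombic faces, indexed by coordinates instead of positions.\<close>

definition cell :: "'m \<Rightarrow> 'm \<Rightarrow> (real ^ 'm::finite) set" where
  "cell p q = {x \<in> H_space. x $ p - x $ q = 1 \<and> (\<forall>k. x $ q \<le> x $ k \<and> x $ k \<le> x $ p)}"

text \<open>If \<open>x_p - x_q\<close> attains the bound 1, the bounds on \<open>x_p - x_k\<close>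
  and \<open>x_k - x_q\<close> force \<open>x_k\<close> to lie between \<open>x_q\<close> and
  \<open>x_p\<close>; conversely, the whole range of coordinates then has length 1.\<close>

lemma cell_eq_Int_voronoi0:
  fixes p q :: "'m::finite"
  shows "cell p q = voronoi0 \<inter> {x. x $ p - x $ q = 1}"
proof -
  have "x $ q \<le> x $ k \<and> x $ k \<le> x $ p"
    if "\<forall>p q. x $ p - x $ q \<le> 1" "x $ p - x $ q = 1" for x :: "real ^ 'm" and k
    using that(1)[rule_format, of p k] that(1)[rule_format, of k q] that(2) by linarith
  moreover have "x $ r - x $ s \<le> 1"
    if "\<forall>k. x $ q \<le> x $ k \<and> x $ k \<le> x $ p" "x $ p - x $ q = 1" for x :: "real ^ 'm" and r s
    using that(1)[rule_format, of r] that(1)[rule_format, of s] that(2) by linarith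
  ultimately show ?thesis unfolding cell_def voronoi0_eq by blast
qed

lemma cell_face_of_voronoi0:
  fixes p q :: "'m::finite"
  shows "cell p q face_of voronoi0"
proof -
  have "cell p q = voronoi0 \<inter> {x. (axis p 1 - axis q 1) \<bullet> x = 1}"
    unfolding cell_eq_Int_voronoi0 inner_unit_diff ..
  moreover have "(axis p 1 - axis q 1) \<bullet> x \<le> 1" if "x \<in> voronoi0" for x
    using that unfolding inner_unit_diff voronoi0_eq by blast
  ultimately show ?thesis
    using face_of_Int_supporting_hyperplane_le[OF convex_voronoi0] by metis
qed

text \<open>The orthogonal projection of \<open>axis k 1\<close> onto \<open>H_space\<close>. All
  these projections together sum to 0.\<close>

definition xi_at :: "'m \<Rightarrow> real ^ 'm::finite" where
  "xi_at k = axis k 1 - (1 / real CARD('m)) *\<^sub>R all_ones"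

lemma xi_at_nth: "xi_at k $ r = (if r = k then 1 else 0) - 1 / real CARD('m)"
  for k :: "'m::finite"
  unfolding xi_at_def all_ones_def axis_def by simp

lemma xi_at_in_H_space: "xi_at k \<in> H_space"
  unfolding H_space_iff xi_at_nth by (simp add: sum_subtractf)

lemma sum_xi_at_in_H_space: "(\<Sum>k\<in>K. t k *\<^sub>R xi_at k) \<in> H_space"
  by (intro subspace_sum[OF subspace_H_space] subspace_scale[OF subspace_H_space] xi_at_in_H_space)

text \<open>The subtracted quotient does not depend on \<open>r\<close>, so differences of
  coordinates are differences of coefficients.\<close>

lemma sum_xi_at_nth:
  "(\<Sum>k\<in>K. t k *\<^sub>R xi_at k) $ r = (if r \<in> K then t r else 0) - (\<Sum>k\<in>K. t k) / real CARD('m)"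
  for K :: "'m::finite set"
proof -
  have "(\<Sum>k\<in>K. t k *\<^sub>R xi_at k) $ r = (\<Sum>k\<in>K. (if r = k then t k else 0) - t k / real CARD('m))"
    unfolding sum_component by (rule sum.cong) (simp_all add: xi_at_nth algebra_simps)
  also have "\<dots> = (if r \<in> K then t r else 0) - (\<Sum>k\<in>K. t k) / real CARD('m)"
    by (simp add: sum_subtractf sum_divide_distrib sum.delta')
  finally show ?thesis .
qed

lemma inj_xi_at: "inj (xi_at :: 'm::finite \<Rightarrow> _)"
proof (rule injI)
  fix k l :: 'm assume "xi_at k = xi_at l"
  then have "xi_at k $ k = xi_at l $ k" by simp
  then show "k = l" unfolding xi_at_nth by (simp split: if_splits)
qed

text \<open>Leaving out one index destroys the relation that all \<open>xi_at\<close> sum to 0: at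
  \<open>q\<close> no coefficient contributes, so the difference of the coordinates at
  \<open>k\<close> and \<open>q\<close> isolates the coefficient of \<open>xi_at k\<close>.\<close>

lemma independent_xi_at:
  fixes K :: "'m::finite set"
  assumes "q \<notin> K"
  shows "independent (xi_at ` K)"
proof
  have inj: "inj_on xi_at K" using inj_xi_at by (rule inj_on_subset) simp
  assume "dependent (xi_at ` K)"
  then obtain u k where k: "k \<in> K" "u (xi_at k) \<noteq> 0" and "(\<Sum>v\<in>xi_at ` K. u v *\<^sub>R v) = 0"
    by (auto simp: dependent_finite)
  then have z: "(\<Sum>k\<in>K. u (xi_at k) *\<^sub>R xi_at k) = 0" by (simp add: sum.reindex[OF inj])
  have "(\<Sum>k\<in>K. u (xi_at k) *\<^sub>R xi_at k) $ k - (\<Sum>k\<in>K. u (xi_at k) *\<^sub>R xi_at k) $ q = u (xi_at k)"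
    unfolding sum_xi_at_nth using k(1) assms by simp
  then show False using k(2) unfolding z by simp
qed

lemma parallelepiped_on_image:
  assumes "inj_on f K"
  shows "parallelepiped_on a (f ` K) = {a + (\<Sum>k\<in>K. t k *\<^sub>R f k) | t. \<forall>k\<in>K. 0 \<le> t k \<and> t k \<le> 1}"
    (is "_ = ?R")
proof
  show "parallelepiped_on a (f ` K) \<subseteq> ?R"
  proof
    fix x assume "x \<in> parallelepiped_on a (f ` K)"
    then obtain t where t: "x = a + (\<Sum>b\<in>f ` K. t b *\<^sub>R b)" "\<forall>b\<in>f ` K. 0 \<le> t b \<and> t b \<le> 1"
      unfolding parallelepiped_on_def by blast
    then have "x = a + (\<Sum>k\<in>K. t (f k) *\<^sub>R f k)" by (simp add: sum.reindex[OF assms])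
    then show "x \<in> ?R" using t(2) by (intro CollectI exI[of _ "\<lambda>k. t (f k)"]) auto
  qed
  show "?R \<subseteq> parallelepiped_on a (f ` K)"
  proof
    fix x assume "x \<in> ?R"
    then obtain t where t: "x = a + (\<Sum>k\<in>K. t k *\<^sub>R f k)" "\<forall>k\<in>K. 0 \<le> t k \<and> t k \<le> 1" by blast
    let ?s = "\<lambda>b. t (inv_into K f b)"
    have "x = a + (\<Sum>b\<in>f ` K. ?s b *\<^sub>R b)"
      unfolding t(1) using assms by (simp add: sum.reindex)
    moreover have "\<forall>b\<in>f ` K. 0 \<le> ?s b \<and> ?s b \<le> 1" using t(2) assms by simp
    ultimately show "x \<in> parallelepiped_on a (f ` K)"
      unfolding parallelepiped_on_def by (intro CollectI exI[of _ ?s] conjI)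
  qed
qed

lemma cell_eq_parallelepiped_on:
  fixes p q :: "'m::finite"
  assumes "p \<noteq> q"
  shows "cell p q = parallelepiped_on (xi_at p) (xi_at ` (- {p, q}))"
proof -
  let ?K = "- {p, q}" and ?N = "real CARD('m)"
  let ?f = "\<lambda>t. xi_at p + (\<Sum>k\<in>?K. t k *\<^sub>R xi_at k)"
  have fH: "?f t \<in> H_space" for t
    by (rule subspace_add[OF subspace_H_space xi_at_in_H_space sum_xi_at_in_H_space])
  have fn: "?f t $ r = (if r = p then 1 else if r = q then 0 else t r) - (1 + (\<Sum>k\<in>?K. t k)) / ?N"
    for t r
    unfolding vector_add_component sum_xi_at_nth xi_at_nth
    using assms by (simp add: add_divide_distrib)
  have "x \<in> cell p q \<longleftrightarrow> (\<exists>t. x = ?f t \<and> (\<forall>k\<in>?K. 0 \<le> t k \<and> t k \<le> 1))" for x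
  proof
    assume x: "x \<in> cell p q"
    have "x = ?f (\<lambda>k. x $ k - x $ q)"
    proof (rule H_space_eqI[OF _ fH])
      show "x \<in> H_space" using x unfolding cell_def by blast
      \<comment> \<open>Up to a common shift, the combination has coordinate 1 at \<open>p\<close>,
        0 at \<open>q\<close> and \<open>x_k - x_q\<close> elsewhere, which are exactly the
        coordinates of \<open>x\<close> measured from \<open>x_q\<close>.\<close>
      show "x $ k - ?f (\<lambda>k. x $ k - x $ q) $ k
          = x $ q + (1 + (\<Sum>k\<in>?K. x $ k - x $ q)) / ?N" for k
        unfolding fn using x unfolding cell_def by auto
    qed
    moreover have "\<forall>k\<in>?K. 0 \<le> x $ k - x $ q \<and> x $ k - x $ q \<le> 1"
      using x unfolding cell_def by (smt (verit) mem_Collect_eq)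
    ultimately show "\<exists>t. x = ?f t \<and> (\<forall>k\<in>?K. 0 \<le> t k \<and> t k \<le> 1)"
      by (intro exI[of _ "\<lambda>k. x $ k - x $ q"] conjI)
  next
    assume "\<exists>t. x = ?f t \<and> (\<forall>k\<in>?K. 0 \<le> t k \<and> t k \<le> 1)"
    then obtain t where t: "x = ?f t" "\<forall>k\<in>?K. 0 \<le> t k \<and> t k \<le> 1" by blast
    have "x $ p - x $ q = 1" unfolding t(1) fn using assms by simp
    moreover have "x $ q \<le> x $ k \<and> x $ k \<le> x $ p" for k
      unfolding t(1) fn using t(2) assms by auto
    ultimately show "x \<in> cell p q" unfolding cell_def using fH t(1) by blast
  qed
  then show ?thesis
    unfolding parallelepiped_on_image[OF inj_on_subset[OF inj_xi_at subset_UNIV]] by blast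
qed

lemma aff_dim_cell:
  fixes p q :: "'m::finite"
  assumes "p \<noteq> q"
  shows "aff_dim (cell p q) = int CARD('m) - 2"
proof -
  have "card (xi_at ` (- {p, q})) = card (- {p, q})"
    by (rule card_image) (rule inj_on_subset[OF inj_xi_at subset_UNIV])
  moreover have "card (- {p, q}) = CARD('m) - 2"
    using assms by (simp add: Compl_eq_Diff_UNIV card_Diff_subset)
  moreover have "2 \<le> CARD('m)"
    using card_mono[of UNIV "{p, q}"] assms by simp
  moreover have "independent (xi_at ` (- {p, q}))" by (rule independent_xi_at[of q]) simp
  ultimately show ?thesis
    unfolding cell_eq_parallelepiped_on[OF assms] by (simp add: aff_dim_parallelepiped_on of_nat_diff)
qed

lemma hyper_rhombus_cell:
  fixes p q :: "'m::finite"
  assumes "p \<noteq> q"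
  shows "hyper_rhombus (CARD('m) - 2) (cell p q)"
  unfolding cell_eq_parallelepiped_on[OF assms]
proof (rule hyper_rhombus_parallelepiped_on)
  show "independent (xi_at ` (- {p, q}))" by (rule independent_xi_at[of q]) simp
  have "card (xi_at ` (- {p, q})) = card (- {p, q})"
    by (rule card_image) (rule inj_on_subset[OF inj_xi_at subset_UNIV])
  also have "\<dots> = CARD('m) - 2"
    using assms by (simp add: Compl_eq_Diff_UNIV card_Diff_subset)
  finally show "card (xi_at ` (- {p, q})) = CARD('m) - 2" .
  \<comment> \<open>As \<open>xi_at k\<close> is orthogonal to \<open>all_ones\<close>, the second
    factor can be replaced by the unit vector \<open>axis l 1\<close>.\<close>
  have inn: "xi_at k \<bullet> xi_at l = (if k = l then 1 else 0) - 1 / real CARD('m)" for k l :: 'm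
  proof -
    have "xi_at k \<bullet> all_ones = 0" using xi_at_in_H_space unfolding H_space_def by blast
    then have "xi_at k \<bullet> xi_at l = xi_at k \<bullet> axis l 1"
      by (simp add: xi_at_def[of l] inner_diff_right)
    then show ?thesis by (simp add: inner_axis xi_at_nth)
  qed
  show "norm b = norm b'" if "b \<in> xi_at ` (- {p, q})" "b' \<in> xi_at ` (- {p, q})" for b b'
    using that by (auto simp: norm_eq_sqrt_inner inn)
  show "b \<bullet> b' = d \<bullet> d'"
    if "b \<in> xi_at ` (- {p, q})" "b' \<in> xi_at ` (- {p, q})" "d \<in> xi_at ` (- {p, q})"
      "d' \<in> xi_at ` (- {p, q})" "b \<noteq> b'" "d \<noteq> d'" for b b' d d'
    using that by (auto simp: inn split: if_splits)
qed

text \<open>The midpoint between 0 and the root has coordinates 1/2 at \<open>p\<close>, -1/2 at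
  \<open>q\<close> and 0 elsewhere, so a coordinate difference 1 occurs for one ordered pair only.
  This point therefore tells the cells apart.\<close>

lemma center_in_cell_iff:
  fixes p q :: "'m::finite"
  assumes "p \<noteq> q"
  shows "(1 / 2) *\<^sub>R (axis p 1 - axis q 1) \<in> cell p' q' \<longleftrightarrow> p' = p \<and> q' = q"
proof
  assume "(1 / 2) *\<^sub>R (axis p 1 - axis q 1) \<in> cell p' q'"
  then have "((1 / 2) *\<^sub>R (axis p 1 - axis q 1) :: real ^ 'm) $ p'
      - ((1 / 2) *\<^sub>R (axis p 1 - axis q 1) :: real ^ 'm) $ q' = 1"
    unfolding cell_def by blast
  then show "p' = p \<and> q' = q" by (auto simp: axis_def split: if_splits)
next
  assume "p' = p \<and> q' = q"
  moreover have "(1 / 2) *\<^sub>R (axis p 1 - axis q 1) \<in> cell p q"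
    unfolding cell_def using assms unit_diff_in_A_lattice[of p q] subspace_scale[OF subspace_H_space]
    by (auto simp: axis_def A_lattice_def)
  ultimately show "(1 / 2) *\<^sub>R (axis p 1 - axis q 1) \<in> cell p' q'" by simp
qed

lemma cell_eq_iff:
  fixes p q :: "'m::finite"
  assumes "p \<noteq> q"
  shows "cell p q = cell p' q' \<longleftrightarrow> p = p' \<and> q = q'"
  using center_in_cell_iff[OF assms, of p q] center_in_cell_iff[OF assms, of p' q'] by auto

section \<open>Boundary, facets and corners of the Voronoi cell\<close>

lemma closed_voronoi0: "closed (voronoi0 :: (real ^ 'm::finite) set)"
proof -
  have "voronoi0 = {x :: real ^ 'm. x \<bullet> all_ones = 0} \<inter> (\<Inter>p q. {x. x $ p - x $ q \<le> 1})"
    unfolding voronoi0_eq H_space_def by auto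
  also have "closed \<dots>"
    by (intro closed_Int closed_INT ballI closed_Collect_le closed_Collect_eq continuous_intros)
  finally show ?thesis .
qed

lemma closed_cell:
  fixes p q :: "'m::finite"
  shows "closed (cell p q)"
proof -
  have "cell p q = voronoi0 \<inter> {x. x $ p - x $ q = 1}" by (rule cell_eq_Int_voronoi0)
  also have "closed \<dots>"
    by (intro closed_Int closed_voronoi0 closed_Collect_eq continuous_intros)
  finally show ?thesis .
qed

text \<open>The cells are distinct faces of one convex set and none contains another, so they can only
  meet along their relative boundaries.\<close>

lemma cell_Int_cell:
  fixes p q :: "'m::finite"
  assumes "p \<noteq> q" "(p, q) \<noteq> (p', q')"
  shows "cell p q \<inter> cell p' q' \<subseteq> rel_frontier (cell p q)"
proof -
  have "cell p q \<inter> cell p' q' face_of cell p q"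
    by (rule face_of_subset[OF face_of_Int[OF cell_face_of_voronoi0 cell_face_of_voronoi0]
          Int_lower1 face_of_imp_subset[OF cell_face_of_voronoi0]])
  moreover have "cell p q \<inter> cell p' q' \<noteq> cell p q"
  proof -
    let ?z = "(1 / 2) *\<^sub>R (axis p 1 - axis q 1)"
    have "?z \<in> cell p q" "?z \<notin> cell p' q'"
      using assms(2) unfolding center_in_cell_iff[OF assms(1)] by auto
    then show ?thesis by blast
  qed
  ultimately have "(cell p q \<inter> cell p' q') \<inter> rel_interior (cell p q) = {}"
    by (rule face_of_disjoint_rel_interior)
  then show ?thesis unfolding rel_frontier_def closure_closed[OF closed_cell] by auto
qed

lemma composed_of_cells:
  fixes X :: "(real ^ 'm::finite) set"
  assumes "X = (\<Union>(p, q)\<in>{(p, q). p \<noteq> q}. cell p q)"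
  shows "composed_of X {cell p q | p q. p \<noteq> q}"
  unfolding composed_of_def
proof (intro conjI ballI impI)
  show "\<Union>{cell p q | p q. p \<noteq> q} = X" unfolding assms by auto
  fix A B :: "(real ^ 'm) set"
  assume "A \<in> {cell p q | p q. p \<noteq> q}" "B \<in> {cell p q | p q. p \<noteq> q}" "A \<noteq> B"
  then obtain p q p' q' where "A = cell p q" "B = cell p' q'" "p \<noteq> q" "p' \<noteq> q'" "(p, q) \<noteq> (p', q')"
    by blast
  then show "A \<inter> B \<subseteq> rel_frontier A \<inter> rel_frontier B"
    using cell_Int_cell[of p q p' q'] cell_Int_cell[of p' q' p q] by auto
qed

text \<open>Where all inequalities are strict, the point is interior relative to
  \<open>H_space\<close>. A point with a tight inequality is not: stretching it by
  \<open>1 + d\<close> stays in \<open>H_space\<close> but raises the tight difference from 1 to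
  \<open>1 + d\<close>.\<close>

lemma boundary0_eq:
  "(boundary0 :: (real ^ 'm::finite) set) = (\<Union>(p, q)\<in>{(p, q). p \<noteq> q}. cell p q)"
proof -
  let ?H = "H_space :: (real ^ 'm) set" and ?V = "voronoi0 :: (real ^ 'm) set"
  let ?T = "{x \<in> ?H. \<forall>p q. x $ p - x $ q < 1}"
  have sub: "?V \<subseteq> ?H" unfolding voronoi0_def by blast
  have cl: "top_of_set ?H closure_of ?V = ?V"
    using closed_subset[OF sub closed_voronoi0] by (simp add: closure_of_closedin)
  have eq: "?T = ?H \<inter> (\<Inter>p q. {x. x $ p - x $ q < 1})" by auto
  have "openin (top_of_set ?H) ?T"
    unfolding eq
  proof (rule openin_open_Int)
    show "open (\<Inter>p q. {x :: real ^ 'm. x $ p - x $ q < 1})"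
      by (intro open_INT ballI finite open_Collect_less continuous_intros)
  qed
  moreover have "?T \<subseteq> ?V" unfolding voronoi0_eq by (auto intro: less_imp_le)
  ultimately have T: "?T \<subseteq> top_of_set ?H interior_of ?V" by (intro interior_of_maximal)
  have "x $ p - x $ q \<noteq> 1" if x: "x \<in> top_of_set ?H interior_of ?V" for x p q
  proof
    assume one: "x $ p - x $ q = 1"
    obtain U where U: "openin (top_of_set ?H) U" "x \<in> U" "U \<subseteq> ?V"
      using x unfolding interior_of_def by blast
    have "\<forall>y\<in>U. \<exists>e>0. ball y e \<inter> ?H \<subseteq> U"
      using U(1) unfolding openin_contains_ball by (rule conjunct2)
    from bspec[OF this U(2)] obtain e where e: "0 < e" "ball x e \<inter> ?H \<subseteq> U" by (elim exE conjE)
    \<comment> \<open>Chosen so that \<open>d * norm x < e\<close>; the added 1 keeps the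
      denominator positive at \<open>x = 0\<close>.\<close>
    define d where "d = e / (norm x + 1)"
    have pos: "0 < norm x + 1" by (simp add: add_nonneg_pos)
    have d: "0 < d" unfolding d_def using e(1) pos by (rule divide_pos_pos)
    have "d * norm x < d * (norm x + 1)" using d by simp
    also have "\<dots> = e" unfolding d_def using pos by (simp only: times_divide_eq_left) simp
    finally have "x + d *\<^sub>R x \<in> ball x e" using d by (simp add: dist_norm)
    moreover have "x + d *\<^sub>R x \<in> ?H"
      using U sub subspace_H_space by (blast intro: subspace_add subspace_scale)
    ultimately have "x + d *\<^sub>R x \<in> ?V" using e(2) U(3) by blast
    then have "(x + d *\<^sub>R x) $ p - (x + d *\<^sub>R x) $ q \<le> 1" unfolding voronoi0_eq by blast
    moreover have "(x + d *\<^sub>R x) $ p - (x + d *\<^sub>R x) $ q = (1 + d) * (x $ p - x $ q)"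
      by (simp add: algebra_simps)
    ultimately show False using one d by simp
  qed
  then have "x \<in> boundary0 \<longleftrightarrow> x \<in> ?V \<and> (\<exists>p q. x $ p - x $ q = 1)" for x
    unfolding boundary0_def frontier_of_def cl using T unfolding voronoi0_eq
    by (auto simp: less_le)
  moreover have "p \<noteq> q" if "x $ p - x $ q = 1" for p q and x :: "real ^ 'm" using that by auto
  ultimately have "x \<in> boundary0 \<longleftrightarrow> x \<in> (\<Union>(p, q)\<in>{(p, q). p \<noteq> q}. cell p q)" for x :: "real ^ 'm"
    unfolding cell_eq_Int_voronoi0 by fastforce
  then show ?thesis by (rule set_eqI)
qed

lemma is_cell_iff:
  fixes F :: "(real ^ 'm::finite) set"
  assumes N: "CARD('m) = n + 1" "n \<ge> 1"
  shows "is_cell n F \<longleftrightarrow> (\<exists>p q. p \<noteq> q \<and> F = cell p q)"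
proof
  assume "\<exists>p q. p \<noteq> q \<and> F = cell p q"
  then obtain p q where "p \<noteq> q" "F = cell p q" by blast
  then show "is_cell n F"
    unfolding is_cell_def using cell_face_of_voronoi0[of p q] aff_dim_cell[of p q] N(1) by simp
next
  assume "is_cell n F"
  then have F: "F face_of voronoi0" and dimF: "aff_dim F = int n - 1" unfolding is_cell_def by auto
  have dim: "aff_dim (cell p q) = int n - 1" if "p \<noteq> q" for p q :: 'm
    using aff_dim_cell[OF that] N(1) by simp
  \<comment> \<open>The empty set has affine dimension -1, which \<open>n \<ge> 1\<close> rules
    out.\<close>
  have "F \<noteq> {}" using dimF N(2) by auto
  then obtain x where x: "x \<in> rel_interior F"
    using rel_interior_eq_empty face_of_imp_convex[OF F] by blast
  then have xF: "x \<in> F" using rel_interior_subset by blast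
  then have xV: "x \<in> voronoi0" using F face_of_imp_subset by blast
  have "\<exists>p q. x $ p - x $ q = 1"
  proof (rule ccontr)
    assume "\<not> ?thesis"
    then have strict: "0 < 1 - (x $ p - x $ q)" for p q
      using xV unfolding voronoi0_eq by (metis (mono_tags, lifting) diff_gt_0_iff_gt less_le mem_Collect_eq)
    have "F = voronoi0"
    proof (rule face_of_eq_if_extendable[OF F xF])
      fix y :: "real ^ 'm" assume y: "y \<in> voronoi0"
      \<comment> \<open>For \<open>z = x + e (x - y)\<close> the expression is
        \<open>1 - (z_p - z_q)\<close>.\<close>
      have "\<forall>\<^sub>F e in at_right 0. \<forall>p\<in>UNIV. \<forall>q\<in>UNIV.
          0 < (1 - (x $ p - x $ q)) + e * ((y $ p - x $ p) - (y $ q - x $ q))"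
        using strict by (intro eventually_ball_finite ballI eventually_strict_at_right) auto
      moreover have "\<forall>\<^sub>F e in at_right 0. (0::real) < e" by (rule eventually_at_right_less)
      ultimately have "\<forall>\<^sub>F e in at_right 0. 0 < e \<and> (\<forall>p\<in>UNIV. \<forall>q\<in>UNIV.
          0 < (1 - (x $ p - x $ q)) + e * ((y $ p - x $ p) - (y $ q - x $ q)))"
        by (rule eventually_conj[rotated])
      then obtain e where e: "0 < e"
          "\<And>p q. 0 < (1 - (x $ p - x $ q)) + e * ((y $ p - x $ p) - (y $ q - x $ q))"
        using eventually_happens'[OF trivial_limit_at_right_real] by blast
      have "x + e *\<^sub>R (x - y) \<in> H_space"
        using xV y subspace_H_space unfolding voronoi0_eq
        by (auto intro!: subspace_add subspace_scale subspace_diff)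
      moreover have "(x + e *\<^sub>R (x - y)) $ p - (x + e *\<^sub>R (x - y)) $ q \<le> 1" for p q
        using e(2)[of p q] by (simp add: algebra_simps)
      ultimately have "x + e *\<^sub>R (x - y) \<in> voronoi0" unfolding voronoi0_eq by blast
      then show "\<exists>e>0. x + e *\<^sub>R (x - y) \<in> voronoi0" using e(1) by blast
    qed
    \<comment> \<open>The dimension of \<open>voronoi0\<close> need not be computed: if
      \<open>F\<close> were all of it, then any \<open>cell p q\<close> would be a face of the same
      dimension and hence also all of it, although it misses 0.\<close>
    moreover obtain p q :: 'm where pq: "p \<noteq> q"
      using card_le_Suc0_iff_eq[of "UNIV :: 'm set"] N by auto
    ultimately have "cell p q = voronoi0"
      using face_of_aff_dim_lt[OF convex_voronoi0 cell_face_of_voronoi0] dim[OF pq] dimF by force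
    moreover have "0 \<in> (voronoi0 :: (real ^ 'm) set)"
      unfolding voronoi0_eq using subspace_0[OF subspace_H_space] by simp
    ultimately have "0 \<in> cell p q" by simp
    then show False unfolding cell_def by simp
  qed
  then obtain p q where pq: "x $ p - x $ q = 1" by blast
  then have ne: "p \<noteq> q" by auto
  have "x \<in> cell p q" unfolding cell_eq_Int_voronoi0 using xV pq by blast
  then have "F = cell p q"
    using facet_eq_if_meets_rel_interior[OF convex_voronoi0 F cell_face_of_voronoi0 x] dim[OF ne] dimF
    by simp
  then show "\<exists>p q. p \<noteq> q \<and> F = cell p q" using ne by blast
qed

text \<open>Coordinates summing to 0 cannot have exactly one nonzero entry. A nonzero lattice vector
  thus has two nonzero integer entries and squared norm at least 2, the squared norm of a
  root.\<close>

lemma nearest_neighbor_unit_diff: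
  fixes p q :: "'m::finite"
  assumes "p \<noteq> q"
  shows "nearest_neighbor (axis p 1 - axis q 1)"
proof -
  let ?a = "axis p 1 - axis q 1 :: real ^ 'm"
  have aa: "?a \<bullet> ?a = 2" unfolding inner_unit_diff using assms by (simp add: axis_def)
  have "2 \<le> z \<bullet> z" if z: "z \<in> A_lattice" "z \<noteq> 0" for z :: "real ^ 'm"
  proof -
    have "(\<Sum>k\<in>UNIV. z $ k) = 0" using z(1) unfolding A_lattice_def H_space_iff by blast
    obtain r where r: "z $ r \<noteq> 0" using z(2) by (auto simp: vec_eq_iff)
    have "\<exists>s. s \<noteq> r \<and> z $ s \<noteq> 0"
    proof (rule ccontr)
      assume "\<not> ?thesis"
      then have "(\<Sum>k\<in>UNIV. z $ k) = (\<Sum>k\<in>UNIV. if k = r then z $ r else 0)"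
        by (intro sum.cong) auto
      then show False using r \<open>(\<Sum>k\<in>UNIV. z $ k) = 0\<close> by simp
    qed
    then obtain s where s: "s \<noteq> r" "z $ s \<noteq> 0" by blast
    have "1 \<le> z $ k * z $ k" if "z $ k \<noteq> 0" for k
    proof -
      have "1 \<le> \<bar>z $ k\<bar>" using z(1) that unfolding A_lattice_def by (simp add: Ints_nonzero_abs_ge1)
      then have "1 * 1 \<le> \<bar>z $ k\<bar> * \<bar>z $ k\<bar>" by (intro mult_mono) auto
      then show ?thesis by simp
    qed
    from this[OF r] this[OF s(2)] s(1) have "2 \<le> (\<Sum>k\<in>{r, s}. z $ k * z $ k)" by simp
    also have "\<dots> \<le> (\<Sum>k\<in>UNIV. z $ k * z $ k)" by (rule sum_mono2) auto
    finally show ?thesis by (simp add: inner_vec_def)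
  qed
  moreover have "?a \<noteq> 0" using aa by fastforce
  ultimately show ?thesis
    unfolding nearest_neighbor_def using unit_diff_in_A_lattice aa by (auto simp: norm_le)
qed

lemma cell_subset_bisecting_hyperplane:
  fixes p q :: "'m::finite"
  assumes "p \<noteq> q"
  shows "cell p q \<subseteq> bisecting_hyperplane 0 (axis p 1 - axis q 1)"
proof
  fix x assume x: "x \<in> cell p q"
  let ?a = "axis p 1 - axis q 1 :: real ^ 'm"
  have "(x - midpoint 0 a) \<bullet> a = a \<bullet> x - (1 / 2) * (a \<bullet> a)" for a :: "real ^ 'm"
    by (simp add: midpoint_def inner_diff_left inner_diff_right inner_commute)
  then have "(x - midpoint 0 ?a) \<bullet> ?a = ?a \<bullet> x - (1 / 2) * (?a \<bullet> ?a)" .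
  also have "\<dots> = 0"
    using x assms unfolding inner_unit_diff cell_def by (simp add: axis_def)
  finally show "x \<in> bisecting_hyperplane 0 ?a"
    using x unfolding bisecting_hyperplane_def cell_def by simp
qed

text \<open>On \<open>H_space\<close> the functional given by \<open>- xi_at q\<close> is
  \<open>- x_q\<close>. Summing \<open>x_k - x_q \<le> 1\<close> over all \<open>k\<close> other
  than \<open>q\<close> bounds \<open>- x_q\<close>, and equality forces every one of these
  differences to be 1, so the maximum over the Voronoi cell is attained at a single point.\<close>

lemma minus_xi_at_face_of_voronoi0:
  fixes q :: "'m::finite"
  assumes "CARD('m) \<ge> 2"
  shows "{- xi_at q} face_of voronoi0"
    and "- xi_at q \<in> cell p q' \<longleftrightarrow> p \<noteq> q \<and> q' = q"
proof -
  have mem: "- xi_at q \<in> H_space" using xi_at_in_H_space subspace_neg[OF subspace_H_space] by blast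
  show mc: "- xi_at q \<in> cell p q' \<longleftrightarrow> p \<noteq> q \<and> q' = q" for p q'
    unfolding cell_def using mem by (auto simp: xi_at_nth split: if_splits)
  define w :: "real ^ 'm" where "w = - xi_at q"
  have wx: "w \<bullet> x = - x $ q" if "x \<in> H_space" for x
  proof -
    have "x \<bullet> all_ones = 0" using that unfolding H_space_def by blast
    then show ?thesis
      unfolding w_def xi_at_def inner_minus_left inner_diff_left inner_scaleR_left
        inner_commute[of all_ones x] by (simp add: inner_axis')
  qed
  let ?N = "real CARD('m)"
  have bound: "- ?N * x $ q \<le> ?N - 1 \<and> (- ?N * x $ q = ?N - 1 \<longrightarrow> (\<forall>k. k \<noteq> q \<longrightarrow> x $ k - x $ q = 1))"
    if x: "x \<in> voronoi0" for x :: "real ^ 'm"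
  proof -
    have le: "x $ k - x $ q \<le> 1" for k using x unfolding voronoi0_eq by blast
    have "(\<Sum>k\<in>UNIV. x $ k) = 0" using x unfolding voronoi0_eq H_space_iff by blast
    then have "- ?N * x $ q = (\<Sum>k\<in>UNIV. x $ k - x $ q)" by (simp add: sum_subtractf)
    also have "\<dots> = (\<Sum>k\<in>-{q}. x $ k - x $ q)"
      by (rule sum.mono_neutral_right) auto
    finally have eq: "- ?N * x $ q = (\<Sum>k\<in>-{q}. x $ k - x $ q)" .
    have c: "(\<Sum>k\<in>-{q}. 1) = ?N - 1"
      using assms by (simp add: Compl_eq_Diff_UNIV card_Diff_subset of_nat_diff)
    have "(\<Sum>k\<in>-{q}. x $ k - x $ q) \<le> (\<Sum>k\<in>-{q}. 1)" by (rule sum_mono) (rule le)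
    moreover have "x $ k - x $ q = 1"
      if "(\<Sum>k\<in>-{q}. x $ k - x $ q) = (\<Sum>k\<in>-{q}. 1)" "k \<noteq> q" for k
    proof -
      have "(\<Sum>k\<in>-{q}. 1 - (x $ k - x $ q)) = 0" using that(1) by (simp add: sum_subtractf)
      then have "1 - (x $ k - x $ q) = 0"
        using le that(2) by (subst (asm) sum_nonneg_eq_0_iff) auto
      then show ?thesis by simp
    qed
    ultimately show ?thesis unfolding eq c[symmetric] by blast
  qed
  have "{w} = voronoi0 \<inter> {x. w \<bullet> x = (?N - 1) / ?N}"
  proof (intro equalityI subsetI)
    fix x assume "x \<in> {w}"
    moreover have "w \<in> voronoi0"
      unfolding voronoi0_eq using mem by (auto simp: w_def xi_at_nth)
    moreover have "w \<bullet> w = (?N - 1) / ?N"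
      using wx[of w] mem by (simp add: w_def xi_at_nth field_simps)
    ultimately show "x \<in> voronoi0 \<inter> {x. w \<bullet> x = (?N - 1) / ?N}" by simp
  next
    fix x assume "x \<in> voronoi0 \<inter> {x. w \<bullet> x = (?N - 1) / ?N}"
    then have x: "x \<in> voronoi0" "w \<bullet> x = (?N - 1) / ?N" by auto
    have xH: "x \<in> H_space" using x(1) unfolding voronoi0_eq by blast
    have "- ?N * x $ q = ?N - 1" using x(2) wx[OF xH] by (simp add: field_simps)
    then have "x $ k - x $ q = 1" if "k \<noteq> q" for k using bound[OF x(1)] that by blast
    \<comment> \<open>Both points have all coordinates other than the one at \<open>q\<close>
      exactly 1 above it, hence they differ by a constant.\<close>
    then have "x $ k - w $ k = x $ q + 1 - 1 / ?N" for k
      by (cases "k = q") (force simp: w_def xi_at_nth)+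
    then have "x = w" using xH mem unfolding w_def by (intro H_space_eqI)
    then show "x \<in> {w}" by simp
  qed
  moreover have "w \<bullet> x \<le> (?N - 1) / ?N" if "x \<in> voronoi0" for x
  proof -
    have "x \<in> H_space" using that unfolding voronoi0_eq by blast
    then show ?thesis using bound[OF that] wx[of x] by (simp add: field_simps)
  qed
  ultimately show "{- xi_at q} face_of voronoi0"
    using face_of_Int_supporting_hyperplane_le[OF convex_voronoi0] unfolding w_def by metis
qed

section \<open>Permutation matrices\<close>

definition perm_matrix :: "('m \<Rightarrow> 'm) \<Rightarrow> real ^ 'm ^ 'm::finite" where
  "perm_matrix p = (\<chi> r s. if r = p s then 1 else 0)"

lemma permutation_matrices_eq: "permutation_matrices = perm_matrix ` {p. bij p}"
proof -
  have "p permutes UNIV \<longleftrightarrow> bij p" for p :: "'a \<Rightarrow> 'a"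
    using permutes_bij bij_imp_permutes[of p UNIV] by blast
  then show ?thesis unfolding permutation_matrices_def perm_matrix_def by auto
qed

lemma perm_matrix_mult_nth:
  assumes "inj p"
  shows "(perm_matrix p *v x) $ p s = x $ s"
  unfolding perm_matrix_def matrix_vector_mult_def
  using assms by (simp add: inj_eq if_distrib[of "\<lambda>a. a * _"] cong: if_cong)

text \<open>Membership in an image is tested by pulling the point back along \<open>p\<close>, so no
  inverse permutation is needed later.\<close>

lemma image_perm_matrix_iff:
  assumes "bij p"
  shows "y \<in> (*v) (perm_matrix p) ` S \<longleftrightarrow> (\<chi> s. y $ p s) \<in> S"
proof -
  have inj: "inj p" and surj: "surj p" using assms by (auto simp: bij_def)
  have "y = perm_matrix p *v x \<longleftrightarrow> (\<chi> s. y $ p s) = x" for x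
  proof
    assume "y = perm_matrix p *v x"
    then show "(\<chi> s. y $ p s) = x" using perm_matrix_mult_nth[OF inj] by (simp add: vec_eq_iff)
  next
    assume x: "(\<chi> s. y $ p s) = x"
    have "y $ r = (perm_matrix p *v x) $ r" for r
    proof -
      obtain s where r: "r = p s" using surj by (rule surjE)
      show ?thesis unfolding r perm_matrix_mult_nth[OF inj] x[symmetric] by simp
    qed
    then show "y = perm_matrix p *v x" by (simp add: vec_eq_iff)
  qed
  then show ?thesis by (simp add: image_iff)
qed

lemma permuted_in_H_space_iff:
  assumes "bij p"
  shows "(\<chi> s. y $ p s) \<in> H_space \<longleftrightarrow> y \<in> H_space"
  unfolding H_space_iff using sum.reindex_bij_betw[OF assms, of "\<lambda>r. y $ r"] by simp

lemma image_perm_matrix_cell: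
  fixes p :: "'m::finite \<Rightarrow> 'm"
  assumes "bij p"
  shows "(*v) (perm_matrix p) ` cell r s = cell (p r) (p s)"
proof (rule set_eqI)
  fix y :: "real ^ 'm"
  have surj: "surj p" using assms by (rule bij_is_surj)
  have all: "(\<forall>k. P (p k)) \<longleftrightarrow> (\<forall>k. P k)" for P using surj by (metis surjD)
  show "y \<in> (*v) (perm_matrix p) ` cell r s \<longleftrightarrow> y \<in> cell (p r) (p s)"
    unfolding image_perm_matrix_iff[OF assms] cell_def
    using all[of "\<lambda>k. y $ p s \<le> y $ k \<and> y $ k \<le> y $ p r"]
    by (simp add: permuted_in_H_space_iff[OF assms])
qed

lemma norm_perm_matrix_mult:
  assumes "bij p"
  shows "norm (perm_matrix p *v x) = norm x"
proof -
  have "(perm_matrix p *v x) \<bullet> (perm_matrix p *v x)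
      = (\<Sum>s\<in>UNIV. (perm_matrix p *v x) $ p s * (perm_matrix p *v x) $ p s)"
    unfolding inner_vec_def
    using sum.reindex_bij_betw[OF assms, of "\<lambda>r. (perm_matrix p *v x) $ r * (perm_matrix p *v x) $ r"]
    by simp
  also have "\<dots> = x \<bullet> x"
    unfolding perm_matrix_mult_nth[OF bij_is_inj[OF assms]] by (simp add: inner_vec_def)
  finally show ?thesis by (simp add: norm_eq_sqrt_inner)
qed

lemma congruent_cells:
  fixes p q p' q' :: "'m::finite"
  assumes "p \<noteq> q" "p' \<noteq> q'"
  shows "congruent_sets (cell p q) (cell p' q')"
proof -
  \<comment> \<open>The first transposition takes \<open>p\<close> to \<open>p'\<close> and
    \<open>q\<close> to \<open>u\<close>. The second takes \<open>u\<close> to \<open>q'\<close> and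
    leaves \<open>p'\<close> alone, because \<open>p'\<close> differs from both \<open>u\<close> and
    \<open>q'\<close>.\<close>
  define u where "u = Transposition.transpose p p' q"
  define f where "f = Transposition.transpose u q' \<circ> Transposition.transpose p p'"
  have "u \<noteq> p'"
    unfolding u_def using assms(1) by (auto simp: Transposition.transpose_def)
  then have f: "f p = p'" "f q = q'"
    unfolding f_def comp_def u_def[symmetric] using assms(2) by auto
  have b: "bij f" unfolding f_def by (intro bij_comp bij_transpose)
  have "dist (perm_matrix f *v x) (perm_matrix f *v y) = dist x y" for x y
    using norm_perm_matrix_mult[OF b, of "x - y"]
    by (simp add: dist_norm matrix_vector_mult_diff_distrib)
  then show ?thesis
    unfolding congruent_sets_def using image_perm_matrix_cell[OF b, of p q] f
    by (intro exI[of _ "(*v) (perm_matrix f)"]) simp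
qed

section \<open>Cyclic shifts of numbered positions\<close>

lemma inj_on_cyclic_shift: "inj_on (\<lambda>s. (s + j - 1) mod m + 1) {1..m}" for j m :: nat
proof (rule linorder_inj_onI')
  fix s t :: nat assume st: "s \<in> {1..m}" "t \<in> {1..m}" "s < t"
  show "(s + j - 1) mod m + 1 \<noteq> (t + j - 1) mod m + 1"
  proof
    assume "(s + j - 1) mod m + 1 = (t + j - 1) mod m + 1"
    then have "m dvd (t + j - 1) - (s + j - 1)"
      using st mod_eq_dvd_iff_nat[of "s + j - 1" "t + j - 1" m] by simp
    then have "m dvd t - s" using st by (simp add: algebra_simps)
    then show False using st by (auto dest!: dvd_imp_le)
  qed
qed

lemma bij_betw_cyclic_shift: "bij_betw (\<lambda>s. (s + j - 1) mod m + 1) {1..m} {1..m}" for j m :: nat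
proof (rule bij_betw_imageI[OF inj_on_cyclic_shift])
  have "(\<lambda>s. (s + j - 1) mod m + 1) ` {1..m} \<subseteq> {1..m}"
    by (auto simp: Suc_le_eq)
  then show "(\<lambda>s. (s + j - 1) mod m + 1) ` {1..m} = {1..m}"
    by (rule endo_inj_surj[OF finite_atLeastAtMost _ inj_on_cyclic_shift])
qed

section \<open>Labelled coordinates\<close>

text \<open>A locale, because its results are needed for the given numbering and again for every
  enumeration \<open>\<tau>\<close> that arises from sorting coordinates.\<close>

locale labelling =
  fixes n :: nat and c :: "nat \<Rightarrow> 'm::finite"
  assumes n: "n \<ge> 1" and c: "bij_betw c {1..n+1} UNIV"
begin

lemma card_index: "CARD('m) = n + 1"
  using bij_betw_same_card[OF c] by simp

lemma inj_c: "inj_on c {1..n+1}"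
  using c by (rule bij_betw_imp_inj_on)

lemma image_c: "c ` {1..n+1} = UNIV"
  using c by (rule bij_betw_imp_surj_on)

lemma c_surj:
  fixes k :: 'm
  obtains i where "i \<in> {1..n+1}" "k = c i"
  using image_c by blast

lemma c_eq_iff: "i \<in> {1..n+1} \<Longrightarrow> j \<in> {1..n+1} \<Longrightarrow> c i = c j \<longleftrightarrow> i = j"
  using inj_c by (rule inj_on_eq_iff)

lemma xi_eq: "xi n c i = xi_at (c i)"
  unfolding xi_def xi_at_def unit_vec_def card_index ..

lemma rhombic_face_eq:
  assumes "i \<in> {1..n+1}" "j \<in> {1..n+1}" "i \<noteq> j"
  shows "rhombic_face n c i j = cell (c i) (c j)"
proof -
  let ?K = "{1..n+1} - {i, j}"
  have "c ` ?K = c ` {1..n+1} - c ` {i, j}"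
    using assms(1,2) by (intro inj_on_image_set_diff[OF inj_c]) auto
  then have K: "- {c i, c j} = c ` ?K" unfolding image_c by auto
  have ne: "c i \<noteq> c j" using assms c_eq_iff by blast
  have inj: "inj_on (\<lambda>k. xi_at (c k)) ?K"
  proof (rule inj_onI)
    fix k l assume kl: "k \<in> ?K" "l \<in> ?K" "xi_at (c k) = xi_at (c l)"
    have "c k = c l" using inj_xi_at kl(3) by (rule injD)
    then show "k = l" using kl(1,2) c_eq_iff[of k l] by simp
  qed
  have "cell (c i) (c j) = parallelepiped_on (xi_at (c i)) ((\<lambda>k. xi_at (c k)) ` ?K)"
    unfolding cell_eq_parallelepiped_on[OF ne] K image_image ..
  also have "\<dots> = rhombic_face n c i j"
    unfolding parallelepiped_on_image[OF inj] rhombic_face_def diamond_def xi_eq by auto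
  finally show ?thesis ..
qed

lemma rhombic_faces_eq: "rhombic_faces n c = {cell p q | p q. p \<noteq> q}"
proof
  show "rhombic_faces n c \<subseteq> {cell p q | p q. p \<noteq> q}"
    unfolding rhombic_faces_def using rhombic_face_eq c_eq_iff by blast
  show "{cell p q | p q. p \<noteq> q} \<subseteq> rhombic_faces n c"
  proof
    fix F :: "(real ^ 'm) set" assume "F \<in> {cell p q | p q. p \<noteq> q}"
    then obtain p q where pq: "p \<noteq> q" "F = cell p q" by blast
    obtain i where i: "i \<in> {1..n+1}" "p = c i" by (rule c_surj)
    obtain j where j: "j \<in> {1..n+1}" "q = c j" by (rule c_surj)
    note ij = i j
    have "i \<noteq> j" using pq(1) ij by blast
    then have "F = rhombic_face n c i j" using rhombic_face_eq[of i j] pq(2) ij by simp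
    then show "F \<in> rhombic_faces n c"
      unfolding rhombic_faces_def using ij(1,3) \<open>i \<noteq> j\<close> by blast
  qed
qed

lemma corner_cells_eq: "corner_cells n c = (\<lambda>p. cell p (c (n+1))) ` (- {c (n+1)})"
proof -
  have "c ` {1..n} = c ` ({1..n+1} - {n+1})" by (rule arg_cong[where f = "image c"]) auto
  also have "\<dots> = c ` {1..n+1} - c ` {n+1}"
    by (intro inj_on_image_set_diff[OF inj_c]) auto
  also have "\<dots> = - {c (n+1)}" unfolding image_c by auto
  finally have eq: "- {c (n+1)} = c ` {1..n}" ..
  have "corner_cells n c = (\<lambda>i. rhombic_face n c i (n+1)) ` {1..n}"
    unfolding corner_cells_def by blast
  also have "\<dots> = (\<lambda>i. cell (c i) (c (n+1))) ` {1..n}"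
    by (rule image_cong) (auto simp: rhombic_face_eq)
  finally show ?thesis unfolding eq image_image .
qed

lemma image_corner_cells:
  assumes "bij p"
  shows "(`) ((*v) (perm_matrix p)) ` corner_cells n c
       = (\<lambda>r. cell r (p (c (n+1)))) ` (- {p (c (n+1))})"
proof -
  have "p ` (- {c (n+1)}) = - {p (c (n+1))}"
    using assms by (simp add: bij_image_Compl_eq)
  then have eq: "- {p (c (n+1))} = p ` (- {c (n+1)})" ..
  show ?thesis
    unfolding corner_cells_eq eq by (simp add: image_image image_perm_matrix_cell[OF assms])
qed

text \<open>Conjugation by the labelling turns the permutation \<open>f\<close> of positions into
  one of the index type. The conclusion keeps only its effect on labels, which is all that
  determines the images of faces.\<close>

lemma labelled_matrix_eq:
  assumes f: "bij_betw f {1..n+1} {1..n+1}"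
    and A: "\<And>r s. r \<in> {1..n+1} \<Longrightarrow> s \<in> {1..n+1} \<Longrightarrow> A r s = (if r = f s then 1 else 0)"
  shows "\<exists>p. bij p \<and> labelled_matrix n c A = perm_matrix p \<and> (\<forall>s\<in>{1..n+1}. p (c s) = c (f s))"
proof (intro exI conjI ballI)
  let ?g = "inv_into {1..n+1} c"
  let ?p = "c \<circ> f \<circ> ?g"
  have g: "bij_betw ?g UNIV {1..n+1}" using c by (rule bij_betw_inv_into)
  show "bij ?p" using bij_betw_trans[OF bij_betw_trans[OF g f] c] by (simp add: comp_assoc)
  have gc: "?g (c s) = s" if "s \<in> {1..n+1}" for s using inj_c that by (rule inv_into_f_f)
  show "?p (c s) = c (f s)" if "s \<in> {1..n+1}" for s using gc[OF that] by simp
  have gr: "?g r \<in> {1..n+1}" "c (?g r) = r" for r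
    using bij_betwE[OF g] f_inv_into_f[of r c "{1..n+1}"] image_c by auto
  have fg: "f (?g s) \<in> {1..n+1}" for s using bij_betwE[OF f] gr(1) by blast
  have "A (?g r) (?g s) = (if r = ?p s then 1 else 0)" for r s
  proof -
    have "?g r = f (?g s) \<longleftrightarrow> r = ?p s"
      using gr(2)[of r] gc[OF fg[of s]] by auto
    then show ?thesis using A[OF gr(1) gr(1)] by simp
  qed
  then show "labelled_matrix n c A = perm_matrix ?p"
    unfolding labelled_matrix_def perm_matrix_def by simp
qed

lemma circular_shift_eq:
  "\<exists>p. bij p \<and> circular_shift n c j = perm_matrix p \<and>
     (\<forall>s\<in>{1..n+1}. p (c s) = c ((s + j - 1) mod (n + 1) + 1))"
proof -
  have A: "shift_entries (n + 1) j r s = (if r = (s + j - 1) mod (n + 1) + 1 then 1 else 0)" for r s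
    by (simp add: shift_entries_def)
  show ?thesis
    using labelled_matrix_eq[OF bij_betw_cyclic_shift A] unfolding circular_shift_def .
qed

lemma block_shift_eq:
  "\<exists>p. bij p \<and> labelled_matrix n c (block_one n (shift_entries n d)) = perm_matrix p \<and>
     (\<forall>s\<in>{1..n}. p (c s) = c ((s + d - 1) mod n + 1)) \<and> p (c (n+1)) = c (n+1)"
proof -
  \<comment> \<open>The block matrix rotates the first \<open>n\<close> positions and fixes position
    \<open>n+1\<close>.\<close>
  define f where "f s = (if s \<in> {1..n} then (s + d - 1) mod n + 1 else s)" for s
  have "bij_betw f {1..n} {1..n}"
    using bij_betw_cyclic_shift[of d n] by (rule bij_betw_cong[THEN iffD1, rotated]) (simp add: f_def)
  moreover have "bij_betw f {n+1} {n+1}" by (simp add: f_def bij_betw_def)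
  ultimately have "bij_betw f ({1..n} \<union> {n+1}) ({1..n} \<union> {n+1})" by (rule bij_betw_combine) simp
  moreover have "{1..n} \<union> {n+1} = {1..n+1}" by auto
  ultimately have f: "bij_betw f {1..n+1} {1..n+1}" by simp
  have "block_one n (shift_entries n d) r s = (if r = f s then 1 else 0)"
    if rs: "r \<in> {1..n+1}" "s \<in> {1..n+1}" for r s
  proof (cases "s \<le> n")
    case True
    have "(s + d - 1) mod n + 1 \<le> n" using n by (simp add: Suc_le_eq)
    then show ?thesis using True rs by (auto simp: block_one_def shift_entries_def f_def)
  next
    case False
    then show ?thesis using rs by (auto simp: block_one_def f_def)
  qed
  from labelled_matrix_eq[OF f this] obtain p where p: "bij p"
      "labelled_matrix n c (block_one n (shift_entries n d)) = perm_matrix p"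
      "\<forall>s\<in>{1..n+1}. p (c s) = c (f s)"
    by blast
  show ?thesis
  proof (intro exI conjI ballI)
    show "bij p" "labelled_matrix n c (block_one n (shift_entries n d)) = perm_matrix p" by fact+
    show "p (c s) = c ((s + d - 1) mod n + 1)" if "s \<in> {1..n}" for s
      using p(3)[rule_format, of s] that by (simp add: f_def)
    show "p (c (n+1)) = c (n+1)" using p(3)[rule_format, of "n+1"] by (simp add: f_def)
  qed
qed

text \<open>The shift by \<open>j\<close> carries label \<open>n+1\<close> to
  \<open>(n + j) mod (n + 1) + 1\<close>, and with it the whole collection of cells at that corner.
  As \<open>j\<close> runs through 0 to \<open>n\<close>, this hits every label:
  \<open>j = 0\<close> gives \<open>n+1\<close>, and \<open>j = i\<close> gives any other
  \<open>i\<close>.\<close>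

lemma images_of_corner_cells:
  "(\<lambda>M. (`) ((*v) M) ` corner_cells n c) ` circular_shifts n c
   = (\<lambda>q. (\<lambda>r. cell r q) ` (- {q})) ` UNIV" (is "?L = ?f ` UNIV")
proof -
  let ?s = "\<lambda>j. (n + j) mod (n + 1) + 1"
  have "(`) ((*v) (circular_shift n c j)) ` corner_cells n c = ?f (c (?s j))" for j
  proof -
    obtain p where p: "bij p" "circular_shift n c j = perm_matrix p"
        "\<forall>s\<in>{1..n+1}. p (c s) = c ((s + j - 1) mod (n + 1) + 1)"
      using circular_shift_eq[of j] by blast
    have "p (c (n+1)) = c (?s j)" using p(3)[rule_format, of "n+1"] by simp
    then show ?thesis using image_corner_cells[OF p(1)] p(2) by simp
  qed
  then have "?L = ?f ` c ` ?s ` {0..n}" unfolding circular_shifts_def by (simp add: image_image)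
  also have "?s ` {0..n} = {1..n+1}"
  proof
    show "?s ` {0..n} \<subseteq> {1..n+1}" by (auto simp: less_Suc_eq_le[symmetric])
    show "{1..n+1} \<subseteq> ?s ` {0..n}"
    proof
      fix i assume i: "i \<in> {1..n+1}"
      show "i \<in> ?s ` {0..n}"
      proof (cases "i = n + 1")
        case True
        then show ?thesis by (intro image_eqI[of _ _ 0]) auto
      next
        case False
        then have "n + i = (i - 1) + (n + 1)" "i - 1 < n + 1" using i by auto
        then have "(n + i) mod (n + 1) = i - 1" by (metis mod_add_self2 mod_less)
        then show ?thesis using False i by (intro image_eqI[of _ _ i]) auto
      qed
    qed
  qed
  finally show ?thesis unfolding image_c .
qed

text \<open>Since \<open>n \<ge> 1\<close>, each collection has a member, and that member determines
  the common second index \<open>q\<close>; so the collections are distinct.\<close>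

lemma card_images_of_corner_cells:
  "card ((\<lambda>M. (`) ((*v) M) ` corner_cells n c) ` circular_shifts n c) = n + 1"
proof -
  have "inj (\<lambda>q::'m. (\<lambda>r. cell r q) ` (- {q}))"
  proof (rule injI)
    fix q q' :: 'm assume eq: "(\<lambda>r. cell r q) ` (- {q}) = (\<lambda>r. cell r q') ` (- {q'})"
    have "- {q} \<noteq> {}"
    proof
      assume "- {q} = {}"
      then have "UNIV = {q}" by blast
      then show False using card_index n by (metis One_nat_def Suc_eq_plus1 card_1_singleton_iff nat.inject not_one_le_zero)
    qed
    then obtain p where p: "p \<noteq> q" by blast
    then have "cell p q \<in> (\<lambda>r. cell r q') ` (- {q'})" unfolding eq[symmetric] by blast
    then show "q = q'" using cell_eq_iff[OF p] by blast
  qed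
  then show ?thesis unfolding images_of_corner_cells by (simp add: card_image card_index)
qed

lemma Union_images_of_corner_cells:
  "(\<Union>M\<in>circular_shifts n c. (`) ((*v) M) ` corner_cells n c) = {cell p q | p q. p \<noteq> q}"
  unfolding images_of_corner_cells by blast

lemma card_corner_cells: "card (corner_cells n c) = n"
proof -
  have "inj_on (\<lambda>p. cell p (c (n+1))) (- {c (n+1)})"
    using cell_eq_iff by (intro inj_onI) blast
  then show ?thesis
    unfolding corner_cells_eq by (simp add: card_image Compl_eq_Diff_UNIV card_Diff_subset card_index)
qed

lemma card_rhombic_faces: "card (rhombic_faces n c) = n * (n + 1)"
proof -
  let ?S = "SIGMA q:(UNIV :: 'm set). - {q}"
  have "rhombic_faces n c = (\<lambda>(q, p). cell p q) ` ?S" unfolding rhombic_faces_eq by auto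
  moreover have "inj_on (\<lambda>(q, p). cell p q) ?S"
    using cell_eq_iff by (intro inj_onI) (auto; blast)
  moreover have "card ?S = (n + 1) * n"
    by (simp add: card_SigmaI Compl_eq_Diff_UNIV card_Diff_subset card_index)
  ultimately show ?thesis by (simp add: card_image)
qed

lemma cells_at_corner:
  "{F. is_cell n F \<and> - xi n c (n+1) \<in> F} = corner_cells n c"
proof -
  have "2 \<le> CARD('m)" using card_index n by simp
  then show ?thesis
    unfolding is_cell_iff[OF card_index n] xi_eq corner_cells_eq
    using minus_xi_at_face_of_voronoi0(2)[of "c (n+1)"] by auto
qed

text \<open>The block rotation takes label 1 to \<open>d = cyclic_diff n i j\<close> and fixes
  \<open>n+1\<close>; the shift by \<open>j\<close> then takes \<open>d\<close> to \<open>i\<close>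
  and \<open>n+1\<close> to \<open>j\<close>. It matters that \<open>d\<close> lies in 1 to
  \<open>n\<close>: only then is it a position within the block.\<close>

lemma rhombic_face_image:
  assumes ij: "i \<in> {1..n+1}" "j \<in> {1..n+1}" "i \<noteq> j"
  shows "rhombic_face n c i j =
            (*v) (circular_shift n c (j mod (n + 1)) **
                  labelled_matrix n c
                    (block_one n (shift_entries n ((cyclic_diff n i j - 1) mod n))))
              ` rhombic_face n c 1 (n+1)"
proof -
  define d where "d = cyclic_diff n i j"
  have dint: "int d = (int i - int j) mod int (n + 1)" unfolding d_def cyclic_diff_def by simp
  have "d < n + 1"
    unfolding d_def cyclic_diff_def by (simp add: nat_less_iff)
  moreover have "d \<noteq> 0"
  proof
    assume "d = 0"
    then have "int (n + 1) dvd int i - int j" using dint by (simp add: mod_eq_0_iff_dvd)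
    then have "\<bar>int (n + 1)\<bar> \<le> \<bar>int i - int j\<bar>" using ij(3) by (intro dvd_imp_le_int) auto
    moreover have "\<bar>int i - int j\<bar> < int (n + 1)" using ij by auto
    ultimately show False by simp
  qed
  ultimately have d: "1 \<le> d" "d \<le> n" by auto
  obtain p where p: "bij p" "circular_shift n c (j mod (n + 1)) = perm_matrix p"
      "\<forall>s\<in>{1..n+1}. p (c s) = c ((s + j mod (n + 1) - 1) mod (n + 1) + 1)"
    using circular_shift_eq[of "j mod (n + 1)"] by blast
  obtain r where r: "bij r"
      "labelled_matrix n c (block_one n (shift_entries n ((d - 1) mod n))) = perm_matrix r"
      "\<forall>s\<in>{1..n}. r (c s) = c ((s + (d - 1) mod n - 1) mod n + 1)" "r (c (n+1)) = c (n+1)"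
    using block_shift_eq[of "(d - 1) mod n"] by blast
  have "r (c 1) = c d" using r(3)[rule_format, of 1] n d by simp
  moreover have "p (c d) = c i"
  proof -
    \<comment> \<open>Done over the integers, since \<open>i - j\<close> may be negative and
      subtraction of natural numbers truncates.\<close>
    have "int ((d + j mod (n + 1) - 1) mod (n + 1)) = (int d + int (j mod (n + 1)) - 1) mod int (n + 1)"
      using d by (simp add: zmod_int of_nat_diff)
    also have "\<dots> = ((int i - int j) mod int (n + 1) + int j mod int (n + 1) - 1) mod int (n + 1)"
      unfolding dint by (simp add: zmod_int)
    also have "\<dots> = (((int i - int j) mod int (n + 1) + int j mod int (n + 1)) mod int (n + 1) - 1)
        mod int (n + 1)"
      by (rule mod_diff_left_eq[symmetric])
    also have "\<dots> = (int i mod int (n + 1) - 1) mod int (n + 1)"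
      unfolding mod_add_eq by simp
    also have "\<dots> = (int i - 1) mod int (n + 1)" by (rule mod_diff_left_eq)
    also have "\<dots> = int i - 1" using ij by (intro mod_pos_pos_trivial) auto
    finally have "(d + j mod (n + 1) - 1) mod (n + 1) + 1 = i" using ij by simp
    then show ?thesis using p(3)[rule_format, of d] d by simp
  qed
  ultimately have 1: "p (r (c 1)) = c i" by simp
  have "(n + j mod (n + 1)) mod (n + 1) + 1 = j"
  proof (cases "j = n + 1")
    case False
    then have j: "1 \<le> j" "j < n + 1" using ij by auto
    then have "n + j = (j - 1) + (n + 1)" "j - 1 < n + 1" by auto
    then have "(n + j) mod (n + 1) = j - 1" by (metis mod_add_self2 mod_less)
    then show ?thesis using j by simp
  qed simp
  then have 2: "p (r (c (n+1))) = c j" using p(3)[rule_format, of "n+1"] r(4) by simp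
  have "(*v) (perm_matrix p ** perm_matrix r) ` cell (c 1) (c (n+1))
      = (*v) (perm_matrix p) ` (*v) (perm_matrix r) ` cell (c 1) (c (n+1))"
    by (simp add: image_image matrix_vector_mul_assoc)
  also have "\<dots> = cell (c i) (c j)"
    unfolding image_perm_matrix_cell[OF r(1)] image_perm_matrix_cell[OF p(1)] 1 2 ..
  finally show ?thesis
    unfolding d_def[symmetric] p(2) r(2) using ij n by (simp add: rhombic_face_eq)
qed

end

section \<open>Roofs as order simplices\<close>

text \<open>The closed Weyl chamber of type A belonging to the order \<open>\<tau>\<close>, cut by
  the hyperplane on which its highest root has value 1: the wall of an alcove that avoids the
  origin.\<close>

definition order_simplex :: "nat \<Rightarrow> (nat \<Rightarrow> 'm) \<Rightarrow> (real ^ 'm::finite) set" where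
  "order_simplex n \<tau> = {x \<in> H_space. x $ \<tau> 1 - x $ \<tau> (n+1) = 1 \<and>
     (\<forall>i\<in>{1..n}. x $ \<tau> (i+1) \<le> x $ \<tau> i)}"

lemma order_simplex_cong:
  assumes "\<And>i. i \<in> {1..n+1} \<Longrightarrow> \<tau> i = \<tau>' i"
  shows "order_simplex n \<tau> = order_simplex n \<tau>'"
  unfolding order_simplex_def using assms by auto

lemma order_simplex_antimono:
  assumes "x \<in> order_simplex n \<tau>" "1 \<le> i" "i \<le> k" "k \<le> n + 1"
  shows "x $ \<tau> k \<le> x $ \<tau> i"
  using assms(3,4)
proof (induction k rule: dec_induct)
  case (step k)
  have "x $ \<tau> (k+1) \<le> x $ \<tau> k"
    using assms(1,2) step unfolding order_simplex_def by auto
  then show ?case using step by simp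
qed simp

lemma image_perm_matrix_order_simplex:
  fixes p :: "'m::finite \<Rightarrow> 'm"
  assumes "bij p"
  shows "(*v) (perm_matrix p) ` order_simplex n \<tau> = order_simplex n (p \<circ> \<tau>)"
  by (rule set_eqI)
    (simp add: image_perm_matrix_iff[OF assms] order_simplex_def permuted_in_H_space_iff[OF assms])

lemma convex_order_simplex: "convex (order_simplex n (\<tau> :: nat \<Rightarrow> 'm::finite))"
proof (rule convexI)
  fix x y :: "real ^ 'm" and u v :: real
  assume "x \<in> order_simplex n \<tau>" "y \<in> order_simplex n \<tau>" and uv: "0 \<le> u" "0 \<le> v" "u + v = 1"
  then have x: "x \<in> H_space" "x $ \<tau> 1 - x $ \<tau> (n+1) = 1" "\<forall>i\<in>{1..n}. x $ \<tau> (i+1) \<le> x $ \<tau> i"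
    and y: "y \<in> H_space" "y $ \<tau> 1 - y $ \<tau> (n+1) = 1" "\<forall>i\<in>{1..n}. y $ \<tau> (i+1) \<le> y $ \<tau> i"
    unfolding order_simplex_def by auto
  let ?z = "u *\<^sub>R x + v *\<^sub>R y"
  have "?z \<in> H_space"
    using x(1) y(1) subspace_H_space by (auto intro!: subspace_add subspace_scale)
  moreover have "?z $ \<tau> 1 - ?z $ \<tau> (n+1) = u * (x $ \<tau> 1 - x $ \<tau> (n+1)) + v * (y $ \<tau> 1 - y $ \<tau> (n+1))"
    by (simp add: algebra_simps)
  moreover have "?z $ \<tau> (i+1) \<le> ?z $ \<tau> i" if "i \<in> {1..n}" for i
    using x(3) y(3) uv that by (auto intro!: add_mono mult_left_mono)
  ultimately show "?z \<in> order_simplex n \<tau>"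
    unfolding order_simplex_def using uv x(2) y(2) by simp
qed

context labelling
begin

text \<open>The factor 1 brings the sum into the shape required by \<open>sum_xi_at_nth\<close> and
  \<open>sum_xi_at_in_H_space\<close>.\<close>

lemma sigma_vertex_eq:
  assumes "j \<le> n"
  shows "sigma_vertex n c j = (\<Sum>k\<in>c ` {1..j}. 1 *\<^sub>R xi_at k)"
proof -
  have "inj_on c {1..j}" using assms by (intro inj_on_subset[OF inj_c]) auto
  then show ?thesis unfolding sigma_vertex_def xi_eq by (simp add: sum.reindex)
qed

lemma sigma_vertex_nth:
  assumes j: "j \<le> n" and k: "k \<in> {1..n+1}"
  shows "sigma_vertex n c j $ c k = (if k \<le> j then 1 else 0) - real j / real (n + 1)"
proof -
  have "inj_on c {1..j}" using j by (intro inj_on_subset[OF inj_c]) auto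
  then have "(\<Sum>k\<in>c ` {1..j}. 1) = real j" by (simp add: card_image)
  moreover have "c k \<in> c ` {1..j} \<longleftrightarrow> k \<in> {1..j}"
    using j k by (intro inj_on_image_mem_iff[OF inj_c]) auto
  ultimately show ?thesis
    unfolding sigma_vertex_eq[OF j] sum_xi_at_nth card_index using k by simp
qed

lemma sigma_vertex_in_H_space: "j \<le> n \<Longrightarrow> sigma_vertex n c j \<in> H_space"
  by (simp only: sigma_vertex_eq sum_xi_at_in_H_space)

lemma sigma_vertex_in_order_simplex:
  assumes "j \<in> {1..n}"
  shows "sigma_vertex n c j \<in> order_simplex n c"
proof -
  have j: "j \<le> n" using assms by simp
  have "1 \<in> {1..n+1}" "n + 1 \<in> {1..n+1}" by auto
  from this[THEN sigma_vertex_nth[OF j]]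
  have "sigma_vertex n c j $ c 1 - sigma_vertex n c j $ c (n+1) = 1" using assms by simp
  moreover have "sigma_vertex n c j $ c (i+1) \<le> sigma_vertex n c j $ c i" if "i \<in> {1..n}" for i
    using that sigma_vertex_nth[OF j, of i] sigma_vertex_nth[OF j, of "i+1"] by simp
  ultimately show ?thesis
    unfolding order_simplex_def using sigma_vertex_in_H_space[OF j] by blast
qed

text \<open>The barycentric coordinates of a sorted point are its successive gaps
  \<open>l j\<close>. Sorting makes them nonnegative, and they telescope to the total range, which
  is 1.\<close>

lemma roof_eq_order_simplex: "roof n c = order_simplex n c"
proof
  show "roof n c \<subseteq> order_simplex n c"
    unfolding roof_def
    by (rule hull_minimal) (auto intro: sigma_vertex_in_order_simplex convex_order_simplex)
  show "order_simplex n c \<subseteq> roof n c"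
  proof
    fix x assume x: "x \<in> order_simplex n c"
    then have xH: "x \<in> H_space" and x1: "x $ c 1 - x $ c (n+1) = 1"
      and dec: "\<And>i. i \<in> {1..n} \<Longrightarrow> x $ c (i+1) \<le> x $ c i"
      unfolding order_simplex_def by auto
    define l where "l j = x $ c j - x $ c (j+1)" for j
    have tele: "(\<Sum>j\<in>{k..n}. l j) = x $ c k - x $ c (n+1)" if "k \<le> n + 1" for k
    proof -
      have "{k..n} = {k..<n+1}" by auto
      moreover have "l j = (- x $ c (Suc j)) - (- x $ c j)" for j by (simp add: l_def)
      ultimately show ?thesis using sum_Suc_diff'[OF that, of "\<lambda>j. - x $ c j"] by simp
    qed
    let ?y = "\<Sum>j\<in>{1..n}. l j *\<^sub>R sigma_vertex n c j"
    have "?y \<in> roof n c"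
    proof (rule convex_sum)
      show "convex (roof n c)" unfolding roof_def by (rule convex_convex_hull)
      show "sum l {1..n} = 1" using tele[of 1] x1 by simp
      show "0 \<le> l j" if "j \<in> {1..n}" for j using dec[OF that] unfolding l_def by simp
      show "sigma_vertex n c j \<in> roof n c" if "j \<in> {1..n}" for j
        unfolding roof_def using that by (intro hull_inc) blast
    qed simp
    moreover have "x = ?y"
    proof (rule H_space_eqI[OF xH])
      show "?y \<in> H_space"
        by (intro subspace_sum[OF subspace_H_space] subspace_scale[OF subspace_H_space]
            sigma_vertex_in_H_space) auto
      fix r
      obtain k where k: "k \<in> {1..n+1}" "r = c k" by (rule c_surj)
      have "?y $ c k = (\<Sum>j\<in>{1..n}. l j * ((if k \<le> j then 1 else 0) - real j / real (n + 1)))"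
        unfolding sum_component by (rule sum.cong) (use k in \<open>simp_all add: sigma_vertex_nth\<close>)
      also have "\<dots> = (\<Sum>j\<in>{1..n}. if k \<le> j then l j else 0) - (\<Sum>j\<in>{1..n}. l j * (real j / real (n + 1)))"
        unfolding sum_subtractf[symmetric] by (rule sum.cong) (simp_all add: algebra_simps)
      also have "(\<Sum>j\<in>{1..n}. if k \<le> j then l j else 0) = (\<Sum>j\<in>{k..n}. l j)"
        using k by (intro sum.mono_neutral_cong_right) auto
      also have "\<dots> = x $ c k - x $ c (n+1)" using k tele by simp
      \<comment> \<open>Only vertices with \<open>j \<ge> k\<close> have the entry 1 at
        \<open>c k\<close>; their gaps add up to \<open>x $ c k - x $ c (n+1)\<close>, so the
        remaining difference is the same for all coordinates.\<close>
      finally show "x $ r - ?y $ r = x $ c (n+1) + (\<Sum>j\<in>{1..n}. l j * (real j / real (n + 1)))"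
        unfolding k(2) by simp
    qed
    ultimately show "x \<in> roof n c" by simp
  qed
qed

lemma compact_order_simplex: "compact (order_simplex n c)"
  unfolding roof_eq_order_simplex[symmetric] roof_def by (simp add: finite_imp_compact_convex_hull)

text \<open>Equality of two consecutive coordinates cuts out a face. It is proper, since the vertex
  \<open>v_i\<close> has coordinates at positions \<open>i\<close> and \<open>i+1\<close> that
  differ by 1.\<close>

lemma rel_interior_order_simplex:
  assumes x: "x \<in> rel_interior (order_simplex n c)" and i: "i \<in> {1..n}"
  shows "x $ c (i+1) < x $ c i"
proof (rule ccontr)
  assume not_less: "\<not> ?thesis"
  have xT: "x \<in> order_simplex n c" using x rel_interior_subset by blast
  then have eq: "x $ c i = x $ c (i+1)"
    using not_less i unfolding order_simplex_def by force
  let ?a = "axis (c i) 1 - axis (c (i+1)) 1 :: real ^ 'm"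
  let ?F = "order_simplex n c \<inter> {x. ?a \<bullet> x = 0}"
  have "?F face_of order_simplex n c"
    using i by (intro face_of_Int_supporting_hyperplane_ge convex_order_simplex)
      (auto simp: inner_unit_diff order_simplex_def)
  moreover have "?F \<noteq> order_simplex n c"
  proof -
    have "sigma_vertex n c i \<in> order_simplex n c" using i by (rule sigma_vertex_in_order_simplex)
    moreover have "?a \<bullet> sigma_vertex n c i \<noteq> 0"
      using i sigma_vertex_nth[of i i] sigma_vertex_nth[of i "i+1"] by (simp add: inner_unit_diff)
    ultimately show ?thesis by blast
  qed
  ultimately have "?F \<inter> rel_interior (order_simplex n c) = {}" by (rule face_of_disjoint_rel_interior)
  moreover have "x \<in> ?F" using xT eq by (simp add: inner_unit_diff)
  ultimately show False using x by blast
qed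

text \<open>Already the membership of the two end points fixes the first and the last label.
  Conversely, these points are the vertices \<open>v_1\<close> and \<open>v_n\<close>, the latter
  because all \<open>xi_at\<close> sum to 0, and they span an edge of the simplex.\<close>

lemma edge_face_of_order_simplex_iff:
  "closed_segment (xi_at p) (- xi_at q) face_of order_simplex n c \<longleftrightarrow> c 1 = p \<and> c (n+1) = q"
proof
  assume "closed_segment (xi_at p) (- xi_at q) face_of order_simplex n c"
  then have "xi_at p \<in> order_simplex n c" "- xi_at q \<in> order_simplex n c"
    using face_of_imp_subset by blast+
  then have "xi_at p $ c 1 - xi_at p $ c (n+1) = 1" "(- xi_at q) $ c 1 - (- xi_at q) $ c (n+1) = 1"
    unfolding order_simplex_def by blast+
  then show "c 1 = p \<and> c (n+1) = q" by (auto simp: xi_at_nth split: if_splits)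
next
  assume pq: "c 1 = p \<and> c (n+1) = q"
  have xp: "xi_at p = sigma_vertex n c 1"
    unfolding sigma_vertex_def xi_eq using pq by simp
  have xq: "- xi_at q = sigma_vertex n c n"
  proof (rule H_space_eqI)
    show "- xi_at q \<in> H_space" using xi_at_in_H_space by (rule subspace_neg[OF subspace_H_space])
    show "sigma_vertex n c n \<in> H_space" by (rule sigma_vertex_in_H_space) simp
    fix r
    obtain k where k: "k \<in> {1..n+1}" "r = c k" by (rule c_surj)
    have "c k = q \<longleftrightarrow> k = n + 1" using pq c_eq_iff[of k "n+1"] k(1) by auto
    then show "(- xi_at q) $ r - sigma_vertex n c n $ r = 0"
      unfolding k(2) sigma_vertex_nth[OF order_refl k(1)] using k(1)
      by (auto simp: xi_at_nth card_index field_simps)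
  qed
  show "closed_segment (xi_at p) (- xi_at q) face_of order_simplex n c"
  proof (cases "n = 1")
    case True
    \<comment> \<open>For \<open>n = 1\<close> both end points are \<open>v_1\<close> and the
      segment is a single point.\<close>
    then have "order_simplex n c = {sigma_vertex n c 1}"
      unfolding roof_eq_order_simplex[symmetric] roof_def by simp
    then show ?thesis unfolding xp xq using True by (simp add: face_of_refl)
  next
    case False
    then have n2: "2 \<le> n" using n by simp
    \<comment> \<open>By sortedness this functional is nonnegative, and it vanishes exactly when all
      coordinates strictly between the first and the last position agree. For \<open>n = 2\<close>
      it is 0, and the edge is the entire simplex.\<close>
    let ?a = "axis (c 2) 1 - axis (c n) 1 :: real ^ 'm"
    have ge: "?a \<bullet> x \<ge> 0" if "x \<in> order_simplex n c" for x
      unfolding inner_unit_diff using order_simplex_antimono[OF that, of 2 n] n2 by simp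
    have "closed_segment (xi_at p) (- xi_at q) = order_simplex n c \<inter> {x. ?a \<bullet> x = 0}"
    proof
      have "xi_at p \<in> order_simplex n c" "- xi_at q \<in> order_simplex n c"
        unfolding xp xq using n by (auto intro: sigma_vertex_in_order_simplex)
      moreover have "?a \<bullet> xi_at p = 0" "?a \<bullet> (- xi_at q) = 0"
        using sigma_vertex_nth[of 1 2] sigma_vertex_nth[of 1 n] sigma_vertex_nth[of n 2]
          sigma_vertex_nth[of n n] n2
        by (simp_all only: inner_unit_diff xp xq) simp_all
      ultimately show "closed_segment (xi_at p) (- xi_at q) \<subseteq> order_simplex n c \<inter> {x. ?a \<bullet> x = 0}"
        by (intro closed_segment_subset convex_Int convex_order_simplex convex_hyperplane) auto
      show "order_simplex n c \<inter> {x. ?a \<bullet> x = 0} \<subseteq> closed_segment (xi_at p) (- xi_at q)"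
      proof
        fix x assume x: "x \<in> order_simplex n c \<inter> {x. ?a \<bullet> x = 0}"
        then have xT: "x \<in> order_simplex n c" and eq: "x $ c 2 = x $ c n"
          by (auto simp: inner_unit_diff)
        then have xH: "x \<in> H_space" and x1: "x $ p - x $ q = 1"
          using pq unfolding order_simplex_def by auto
        \<comment> \<open>The common height of the middle coordinates above the smallest one. It
          grows from 0 at \<open>xi_at p\<close> to 1 at \<open>- xi_at q\<close>, so it is the
          parameter on the segment.\<close>
        define u where "u = x $ c 2 - x $ q"
        have u: "0 \<le> u" "u \<le> 1"
          using order_simplex_antimono[OF xT, of 2 "n+1"] order_simplex_antimono[OF xT, of 1 2]
            pq x1 n2 unfolding u_def by auto
        let ?y = "(1 - u) *\<^sub>R xi_at p + u *\<^sub>R (- xi_at q)"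
        have "x = ?y"
        proof (rule H_space_eqI[OF xH])
          show "?y \<in> H_space"
            by (intro subspace_add[OF subspace_H_space] subspace_scale[OF subspace_H_space]
                subspace_neg[OF subspace_H_space] xi_at_in_H_space)
          fix r
          obtain k where k: "k \<in> {1..n+1}" "r = c k" by (rule c_surj)
          have kp: "c k = p \<longleftrightarrow> k = 1" and kq: "c k = q \<longleftrightarrow> k = n + 1"
            using pq c_eq_iff[of k 1] c_eq_iff[of k "n+1"] k(1) by auto
          have "x $ c k = x $ q + (if k = 1 then 1 else if k = n + 1 then 0 else u)"
          proof -
            have "x $ c k = x $ c 2" if "k \<noteq> 1" "k \<noteq> n + 1"
              using order_simplex_antimono[OF xT, of 2 k] order_simplex_antimono[OF xT, of k n]
                that k(1) eq by auto
            then show ?thesis using pq x1 unfolding u_def by auto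
          qed
          then show "x $ r - ?y $ r = x $ q + u + (1 - 2 * u) / real CARD('m)"
            unfolding k(2) using kp kq n2 by (auto simp: xi_at_nth field_simps)
        qed
        then show "x \<in> closed_segment (xi_at p) (- xi_at q)"
          unfolding closed_segment_def using u by blast
      qed
    qed
    then show ?thesis
      using face_of_Int_supporting_hyperplane_ge[OF convex_order_simplex ge] by simp
  qed
qed

lemma order_simplex_subset_cell: "order_simplex n c \<subseteq> cell (c 1) (c (n+1))"
proof
  fix x assume x: "x \<in> order_simplex n c"
  have "x $ c (n+1) \<le> x $ r \<and> x $ r \<le> x $ c 1" for r
  proof -
    obtain k where k: "k \<in> {1..n+1}" "r = c k" by (rule c_surj)
    then show ?thesis
      using order_simplex_antimono[OF x, of k "n+1"] order_simplex_antimono[OF x, of 1 k] by simp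
  qed
  then show "x \<in> cell (c 1) (c (n+1))" using x unfolding cell_def order_simplex_def by blast
qed

end

text \<open>Strict decrease along \<open>\<tau>\<close> makes the coordinates of \<open>x\<close>
  pairwise distinct, and distinct values have only one sorted listing. The values are negated
  because \<open>sorted\<close> means ascending.\<close>

lemma order_unique:
  fixes x :: "real ^ 'm::finite" and \<tau> \<tau>' :: "nat \<Rightarrow> 'm"
  assumes \<tau>: "bij_betw \<tau> {1..n+1} UNIV" "\<And>i. i \<in> {1..n} \<Longrightarrow> x $ \<tau> (i+1) < x $ \<tau> i"
    and \<tau>': "bij_betw \<tau>' {1..n+1} UNIV" "\<And>i. i \<in> {1..n} \<Longrightarrow> x $ \<tau>' (i+1) \<le> x $ \<tau>' i"
    and i: "i \<in> {1..n+1}"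
  shows "\<tau> i = \<tau>' i"
proof -
  let ?L = "\<lambda>t. map (\<lambda>i. - x $ t i) [1..<n+2]"
  have sorted: "sorted (?L t)" if t: "\<And>i. i \<in> {1..n} \<Longrightarrow> x $ t (i+1) \<le> x $ t i" for t
    unfolding sorted_iff_nth_Suc using t by (auto simp del: upt_Suc)
  have strict: "x $ \<tau> k < x $ \<tau> j" if "j < k" "1 \<le> j" "k \<le> n + 1" for j k
    using that(1,3)
  proof (induction k)
    case (Suc k)
    then show ?case using \<tau>(2)[of k] that(2) by (cases "j = k") force+
  qed simp
  have inj: "inj (\<lambda>k. x $ k)"
  proof (rule injI)
    fix r s assume rs: "x $ r = x $ s"
    have "r \<in> \<tau> ` {1..n+1}" "s \<in> \<tau> ` {1..n+1}" using bij_betw_imp_surj_on[OF \<tau>(1)] by auto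
    then obtain j k where jk: "j \<in> {1..n+1}" "r = \<tau> j" "k \<in> {1..n+1}" "s = \<tau> k" by blast
    then have "\<not> j < k" "\<not> k < j" using strict[of j k] strict[of k j] rs by auto
    then show "r = s" using jk by simp
  qed
  have dist: "distinct (?L t)" if "bij_betw t {1..n+1} UNIV" for t
  proof -
    have "inj_on t {1..n+1}" using that by (rule bij_betw_imp_inj_on)
    then have "inj_on (\<lambda>i. - x $ t i) {1..n+1}"
      using inj by (auto simp: inj_on_def)
    moreover have "set [1..<n+2] = {1..n+1}" by auto
    ultimately show ?thesis by (simp add: distinct_map del: upt_Suc)
  qed
  have set: "set (?L t) = range (\<lambda>r. - x $ r)" if "bij_betw t {1..n+1} UNIV" for t
  proof -
    have "set [1..<n+2] = {1..n+1}" by auto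
    then have "set (?L t) = (\<lambda>r. - x $ r) ` t ` {1..n+1}" by (simp add: image_image del: upt_Suc)
    then show ?thesis using bij_betw_imp_surj_on[OF that] by simp
  qed
  have "?L \<tau> = ?L \<tau>'"
  proof (rule sorted_distinct_set_unique)
    show "sorted (?L \<tau>)" "sorted (?L \<tau>')" using sorted \<tau>(2) \<tau>'(2) by (auto simp: less_imp_le)
    show "distinct (?L \<tau>)" "distinct (?L \<tau>')" using dist \<tau>(1) \<tau>'(1) by blast+
    show "set (?L \<tau>) = set (?L \<tau>')" using set \<tau>(1) \<tau>'(1) by metis
  qed
  then have "x $ \<tau> i = x $ \<tau>' i" using i by (auto simp del: upt_Suc)
  then show ?thesis using inj by (simp add: inj_eq)
qed

lemma cell_point_in_order_simplex:
  fixes x :: "real ^ 'm::finite"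
  assumes N: "CARD('m) = n + 1" and pq: "p \<noteq> q" and x: "x \<in> cell p q"
  shows "\<exists>\<tau> :: nat \<Rightarrow> 'm. bij_betw \<tau> {1..n+1} UNIV \<and> \<tau> 1 = p \<and> \<tau> (n+1) = q \<and> x \<in> order_simplex n \<tau>"
proof -
  obtain ys where ys: "set ys = - {p, q}" "distinct ys"
    using finite_distinct_list[of "- {p, q}"] by auto
  let ?f = "\<lambda>k. - x $ k"
  \<comment> \<open>The ends are placed by hand: other coordinates may tie with \<open>x_p\<close>
    or \<open>x_q\<close>, and sorting all indices could then put a different index first or
    last.\<close>
  define zs where "zs = p # sort_key ?f ys @ [q]"
  have setz: "set zs = UNIV" and distz: "distinct zs" unfolding zs_def using ys pq by auto
  have len: "length zs = n + 1" using distinct_card[OF distz] setz N by simp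
  have sorted: "sorted (map ?f zs)"
    unfolding zs_def using x by (auto simp: cell_def sorted_append)
  define \<tau> where "\<tau> i = zs ! (i - 1)" for i
  have "bij_betw ((!) zs) {..<n+1} UNIV" by (rule bij_betw_nth[OF distz]) (auto simp: len setz)
  moreover have "bij_betw (\<lambda>i. i - 1) {1..n+1} {..<n+1}"
    by (rule bij_betw_byWitness[where f' = Suc]) auto
  ultimately have "bij_betw ((!) zs \<circ> (\<lambda>i. i - 1)) {1..n+1} UNIV" by (rule bij_betw_trans[rotated])
  then have "bij_betw \<tau> {1..n+1} UNIV" unfolding \<tau>_def comp_def .
  moreover have "\<tau> 1 = p" unfolding \<tau>_def zs_def by simp
  moreover have "\<tau> (n+1) = q"
  proof -
    have "zs \<noteq> []" unfolding zs_def by simp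
    then have "zs ! n = last zs" using len by (simp add: last_conv_nth)
    then show ?thesis unfolding \<tau>_def by (simp add: zs_def)
  qed
  moreover have "x $ \<tau> (i+1) \<le> x $ \<tau> i" if "i \<in> {1..n}" for i
  proof -
    have i: "i - 1 < length zs" "i < length zs" using that len by auto
    then have "map ?f zs ! (i - 1) \<le> map ?f zs ! i"
      by (intro sorted_nth_mono[OF sorted]) auto
    then show ?thesis unfolding \<tau>_def using i by simp
  qed
  ultimately show ?thesis using x unfolding order_simplex_def cell_def by blast
qed

text \<open>A relative interior point of one simplex has strictly decreasing coordinates along its
  order. By \<open>order_unique\<close> any other simplex through that point has the same order and
  hence is the same set.\<close>

lemma composed_of_order_simplices:
  fixes p q :: "'m::finite"
  assumes n: "n \<ge> 1" and N: "CARD('m) = n + 1" and pq: "p \<noteq> q"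
  shows "composed_of (cell p q)
    {order_simplex n \<tau> | \<tau>. bij_betw \<tau> {1..n+1} UNIV \<and> \<tau> 1 = p \<and> \<tau> (n+1) = q}"
    (is "composed_of _ ?S")
  unfolding composed_of_def
proof (intro conjI ballI impI)
  have lab: "labelling n \<tau>" if "bij_betw \<tau> {1..n+1} (UNIV :: 'm set)" for \<tau>
    using n that by unfold_locales
  show "\<Union>?S = cell p q"
    using cell_point_in_order_simplex[OF N pq] labelling.order_simplex_subset_cell[OF lab] by blast
  have half: "order_simplex n \<tau> \<inter> order_simplex n \<tau>' \<subseteq> rel_frontier (order_simplex n \<tau>)"
    if \<tau>: "bij_betw \<tau> {1..n+1} (UNIV :: 'm set)" and \<tau>': "bij_betw \<tau>' {1..n+1} (UNIV :: 'm set)"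
      and ne: "order_simplex n \<tau> \<noteq> order_simplex n \<tau>'" for \<tau> \<tau>'
  proof
    fix x assume x: "x \<in> order_simplex n \<tau> \<inter> order_simplex n \<tau>'"
    have "x \<notin> rel_interior (order_simplex n \<tau>)"
    proof
      assume "x \<in> rel_interior (order_simplex n \<tau>)"
      then have "x $ \<tau> (i+1) < x $ \<tau> i" if "i \<in> {1..n}" for i
        using labelling.rel_interior_order_simplex[OF lab[OF \<tau>]] that by blast
      moreover have "x $ \<tau>' (i+1) \<le> x $ \<tau>' i" if "i \<in> {1..n}" for i
        using x that unfolding order_simplex_def by blast
      ultimately have "\<tau> i = \<tau>' i" if "i \<in> {1..n+1}" for i
        using order_unique[OF \<tau> _ \<tau>' _ that] by blast
      then show False using ne order_simplex_cong by blast
    qed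
    moreover have "closed (order_simplex n \<tau>)"
      using labelling.compact_order_simplex[OF lab[OF \<tau>]] by (rule compact_imp_closed)
    ultimately show "x \<in> rel_frontier (order_simplex n \<tau>)"
      unfolding rel_frontier_def using x by (simp add: closure_closed)
  qed
  fix A B assume "A \<in> ?S" "B \<in> ?S" "A \<noteq> B"
  then show "A \<inter> B \<subseteq> rel_frontier A \<inter> rel_frontier B" using half by blast
qed

context labelling
begin

lemma roofs_eq:
  "(\<lambda>M. (*v) M ` roof n c) ` permutation_matrices
   = {order_simplex n \<tau> | \<tau>. bij_betw \<tau> {1..n+1} (UNIV :: 'm set)}"
proof -
  have "(\<lambda>M. (*v) M ` roof n c) ` permutation_matrices = (\<lambda>p. order_simplex n (p \<circ> c)) ` {p. bij p}"
    unfolding permutation_matrices_eq image_image roof_eq_order_simplex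
    by (rule image_cong) (simp_all add: image_perm_matrix_order_simplex)
  also have "\<dots> = {order_simplex n \<tau> | \<tau>. bij_betw \<tau> {1..n+1} UNIV}" (is "?L = ?R")
  proof
    show "?L \<subseteq> ?R"
      using bij_betw_trans[OF c] by blast
    show "?R \<subseteq> ?L"
    proof
      fix S :: "(real ^ 'm) set" assume "S \<in> ?R"
      then obtain \<tau> :: "nat \<Rightarrow> 'm" where \<tau>: "bij_betw \<tau> {1..n+1} UNIV" "S = order_simplex n \<tau>" by blast
      let ?p = "\<tau> \<circ> inv_into {1..n+1} c"
      have "bij ?p" using bij_betw_trans[OF bij_betw_inv_into[OF c] \<tau>(1)] .
      moreover have "S = order_simplex n (?p \<circ> c)"
        unfolding \<tau>(2)
      proof (rule order_simplex_cong)
        show "\<tau> i = (?p \<circ> c) i" if "i \<in> {1..n+1}" for i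
          using inv_into_f_f[OF inj_c that] by simp
      qed
      ultimately show "S \<in> ?L" by blast
    qed
  qed
  finally show ?thesis .
qed

lemma composed_of_roofs:
  assumes ij: "i \<in> {1..n+1}" "j \<in> {1..n+1}" "i \<noteq> j"
  shows "composed_of (rhombic_face n c i j)
    (sharing_edge ((\<lambda>M. (*v) M ` roof n c) ` permutation_matrices) (xi n c i) (- xi n c j))"
proof -
  \<comment> \<open>The edge criterion is instantiated at the enumeration \<open>\<tau>\<close> of
    each image of the roof instead of the given labelling.\<close>
  have "closed_segment (xi_at p) (- xi_at q) face_of order_simplex n \<tau> \<longleftrightarrow> \<tau> 1 = p \<and> \<tau> (n+1) = q"
    if "bij_betw \<tau> {1..n+1} (UNIV :: 'm set)" for \<tau> p q
    using labelling.edge_face_of_order_simplex_iff[of n \<tau>] n that unfolding labelling_def by blast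
  then have "sharing_edge ((\<lambda>M. (*v) M ` roof n c) ` permutation_matrices) (xi n c i) (- xi n c j)
     = {order_simplex n \<tau> | \<tau>. bij_betw \<tau> {1..n+1} UNIV \<and> \<tau> 1 = c i \<and> \<tau> (n+1) = c j}"
    unfolding sharing_edge_def roofs_eq xi_eq by blast
  moreover have "c i \<noteq> c j" using ij c_eq_iff by blast
  ultimately show ?thesis
    using composed_of_order_simplices[OF n card_index] rhombic_face_eq[OF ij] by simp
qed

end

theorem lemma9:
  fixes n :: nat and c :: "nat \<Rightarrow> 'm::finite"
  assumes "n \<ge> 1"
    and "bij_betw c {1..n+1} (UNIV :: 'm set)"
  shows
    "{- xi n c (n+1)} face_of voronoi0
     \<and> {F. is_cell n F \<and> - xi n c (n+1) \<in> F} = corner_cells n c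
     \<and> card (corner_cells n c) = n
     \<and> card ((\<lambda>M. (`) ((*v) M) ` corner_cells n c) ` circular_shifts n c) = n + 1
     \<and> composed_of boundary0 (\<Union>M \<in> circular_shifts n c. (`) ((*v) M) ` corner_cells n c)
     \<and> composed_of boundary0 (rhombic_faces n c)
     \<and> card (rhombic_faces n c) = n * (n + 1)
     \<and> (\<forall>F \<in> rhombic_faces n c. is_cell n F \<and> hyper_rhombus (n - 1) F)
     \<and> (\<forall>F \<in> rhombic_faces n c. \<forall>G \<in> rhombic_faces n c. congruent_sets F G)
     \<and> (\<forall>i \<in> {1..n+1}. \<forall>j \<in> {1..n+1}. i \<noteq> j \<longrightarrow>
          rhombic_face n c i j =
            (*v) (circular_shift n c (j mod (n + 1)) **
                  labelled_matrix n c
                    (block_one n (shift_entries n ((cyclic_diff n i j - 1) mod n))))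
              ` rhombic_face n c 1 (n+1)
        \<and> nearest_neighbor (unit_vec c i - unit_vec c j)
        \<and> rhombic_face n c i j \<subseteq> bisecting_hyperplane 0 (unit_vec c i - unit_vec c j)
        \<and> composed_of (rhombic_face n c i j)
            (sharing_edge ((\<lambda>M. (*v) M ` roof n c) ` permutation_matrices)
              (xi n c i) (- xi n c j)))"
proof -
  interpret labelling n c using assms by unfold_locales
  have two: "2 \<le> CARD('m)" using card_index n by simp
  have hyper: "hyper_rhombus (n - 1) (cell p q)" if "p \<noteq> q" for p q :: 'm
    using hyper_rhombus_cell[OF that] card_index by (simp add: diff_Suc split: nat.split)
  show ?thesis
  proof (intro conjI ballI impI)
    show "{- xi n c (n+1)} face_of voronoi0"
      unfolding xi_eq by (rule minus_xi_at_face_of_voronoi0(1)[OF two])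
    show "composed_of boundary0 (\<Union>M \<in> circular_shifts n c. (`) ((*v) M) ` corner_cells n c)"
      unfolding Union_images_of_corner_cells by (rule composed_of_cells[OF boundary0_eq])
    show "composed_of boundary0 (rhombic_faces n c)"
      unfolding rhombic_faces_eq by (rule composed_of_cells[OF boundary0_eq])
    show "is_cell n F" "hyper_rhombus (n - 1) F" if "F \<in> rhombic_faces n c" for F
      using that is_cell_iff[OF card_index n] hyper unfolding rhombic_faces_eq by auto
    show "congruent_sets F G" if "F \<in> rhombic_faces n c" "G \<in> rhombic_faces n c" for F G
      using that congruent_cells unfolding rhombic_faces_eq by blast
    fix i j assume ij: "i \<in> {1..n+1}" "j \<in> {1..n+1}" "i \<noteq> j"
    then have ne: "c i \<noteq> c j" using c_eq_iff by blast
    show "nearest_neighbor (unit_vec c i - unit_vec c j)"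
      unfolding unit_vec_def by (rule nearest_neighbor_unit_diff[OF ne])
    show "rhombic_face n c i j \<subseteq> bisecting_hyperplane 0 (unit_vec c i - unit_vec c j)"
      unfolding unit_vec_def rhombic_face_eq[OF ij] by (rule cell_subset_bisecting_hyperplane[OF ne])
  qed (fact cells_at_corner card_corner_cells card_images_of_corner_cells card_rhombic_faces
      | rule rhombic_face_image composed_of_roofs; assumption)+
qed

end
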